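(* Let $\Omega\subset\mathbb{R}^3$ be a bounded Lipschitz domain, let $p\ge1$, and let $m_1,\dots,m_N\in\mathbb{R}^3$ be slip normals. Let $\{s_j^k\}_{j=1}^N$, $k\in\mathbb{N}$, be a sequence of $N$-tuples of functions $s_j^k\in L^p(\Omega;\mathbb{R}^3)$ with the following properties. (P1) For each $k$, $s_j^k(x)\in m_j^\perp$ for every $j$ and $|s_i^k(x)|\,|s_j^k(x)|=0$ for all $i\ne j$, for a.e. $x\in\Omega$. (P2) For each $j$, $s_j^k\rightharpoonup s_j$ weakly in $L^p(\Omega;\mathbb{R}^3)$ as $k\to\infty$, for some $s_j$. (P3) There is $K<\infty$ such that $\sum_{j=1}^N\int_\Omega|\nabla_{m_j^\perp}s_j^k|\le K$ for all $k\in\mathbb{N}$. Then the limit $\{s_j\}_{j=1}^N$ satisfies the single-plane condition: $s_j(x)\in m_j^\perp$ for every $j$ and $|s_i(x)|\,|s_j(x)|=0$ for all $i\neq j$, for a.e. $x\in\Omega$.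
   Context: Slip normals $m_1,\dots,m_N$ are nonzero fixed vectors in $\mathbb{R}^3$, pairwise linearly independent (normals to distinct slip planes). $\nabla_{m_j^\perp}s_j$ is the distributional gradient of $s_j$ in the directions orthogonal to $m_j$, and $|\nabla_{m_j^\perp}s_j|$ is interpreted as a measure: with $e_1,e_2$ an orthonormal basis of $m_j^\perp$, $\int_\Omega|\nabla_{m_j^\perp}s_j|$ is the total variation of the matrix-valued distribution $(\partial_{e_1}s_j,\partial_{e_2}s_j)$ on $\Omega$ (equal to $+\infty$ if this is not a finite Radon measure). *)

theory Defs
  imports "HOL-Analysis.Analysis"
begin

(* The graph direction is a unit vector n rather than a rotated coordinate axis; g is only
   evaluated on the hyperplane orthogonal to n. *)
definition bounded_lipschitz_domain :: "'a::euclidean_space set \<Rightarrow> bool" where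
  "bounded_lipschitz_domain \<Omega> \<longleftrightarrow>
     \<Omega> \<noteq> {} \<and> open \<Omega> \<and> connected \<Omega> \<and> bounded \<Omega> \<and>
     (\<forall>z \<in> frontier \<Omega>. \<exists>r > 0. \<exists>n g L. norm n = 1 \<and> L-lipschitz_on ({n}\<^sup>\<bottom>) (g :: 'a \<Rightarrow> real) \<and>
        (\<forall>y \<in> ball z r. y \<in> \<Omega> \<longleftrightarrow> g (y - (y \<bullet> n) *\<^sub>R n) < y \<bullet> n))"

(* Elements of Lebesgue spaces are represented by functions on the whole space; values outside
   \<Omega> are irrelevant, and functions that agree a.e. on \<Omega> are not identified. *)
definition Lp :: "real \<Rightarrow> 'a::euclidean_space set \<Rightarrow> ('a \<Rightarrow> 'b::euclidean_space) set" where
  "Lp p \<Omega> = {f \<in> borel_measurable (lebesgue_on \<Omega>).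
     integrable (lebesgue_on \<Omega>) (\<lambda>x. norm (f x) powr p)}"

definition Lp_norm :: "real \<Rightarrow> 'a::euclidean_space set \<Rightarrow> ('a \<Rightarrow> 'b::euclidean_space) \<Rightarrow> real" where
  "Lp_norm p \<Omega> f = (LINT x|lebesgue_on \<Omega>. norm (f x) powr p) powr (1 / p)"

(* The bound forces a functional to take equal values on functions that agree a.e. on \<Omega>, so
   these are exactly the elements of the dual of the quotient space. *)
definition Lp_dual ::
    "real \<Rightarrow> 'a::euclidean_space set \<Rightarrow> (('a \<Rightarrow> 'b::euclidean_space) \<Rightarrow> real) set" where
  "Lp_dual p \<Omega> = {\<Phi>.
     (\<forall>f \<in> Lp p \<Omega>. \<forall>g \<in> Lp p \<Omega>. \<Phi> (\<lambda>x. f x + g x) = \<Phi> f + \<Phi> g) \<and>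
     (\<forall>c. \<forall>f \<in> Lp p \<Omega>. \<Phi> (\<lambda>x. c *\<^sub>R f x) = c * \<Phi> f) \<and>
     (\<exists>C. \<forall>f \<in> Lp p \<Omega>. \<bar>\<Phi> f\<bar> \<le> C * Lp_norm p \<Omega> f)}"

definition Lp_weakly_tendsto ::
    "real \<Rightarrow> 'a::euclidean_space set \<Rightarrow> (nat \<Rightarrow> 'a \<Rightarrow> 'b::euclidean_space) \<Rightarrow> ('a \<Rightarrow> 'b) \<Rightarrow> bool" where
  "Lp_weakly_tendsto p \<Omega> f l \<longleftrightarrow>
     (\<forall>k. f k \<in> Lp p \<Omega>) \<and> l \<in> Lp p \<Omega> \<and> (\<forall>\<Phi> \<in> Lp_dual p \<Omega>. (\<lambda>k. \<Phi> (f k)) \<longlonglongrightarrow> \<Phi> l)"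

fun C_k :: "nat \<Rightarrow> ('a::euclidean_space \<Rightarrow> 'b::euclidean_space) \<Rightarrow> bool" where
  "C_k 0 f \<longleftrightarrow> continuous_on UNIV f"
| "C_k (Suc n) f \<longleftrightarrow>
     f differentiable_on UNIV \<and> (\<forall>v. C_k n (\<lambda>x. frechet_derivative f (at x) v))"

definition test_functions :: "'a::euclidean_space set \<Rightarrow> ('a \<Rightarrow> 'b::euclidean_space) set" where
  "test_functions \<Omega> =
     {\<phi>. (\<forall>n. C_k n \<phi>) \<and> compact (closure {x. \<phi> x \<noteq> 0}) \<and> closure {x. \<phi> x \<noteq> 0} \<subseteq> \<Omega>}"

(* Distributional derivative of u in direction e; the components of the vector-valued
   distribution are tested simultaneously. *)
definition distr_deriv ::
    "'a::euclidean_space set \<Rightarrow> 'a \<Rightarrow> ('a \<Rightarrow> 'b::euclidean_space) \<Rightarrow> ('a \<Rightarrow> 'b) \<Rightarrow> real" where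
  "distr_deriv \<Omega> e u \<phi> =
     - (LINT x|lebesgue_on \<Omega>. u x \<bullet> frechet_derivative \<phi> (at x) e)"

(* Total variation on \<Omega> of the matrix-valued distribution with columns the derivatives of u in
   directions e1 and e2: the supremum over smooth compactly supported matrix fields (\<phi>, \<psi>) of
   pointwise Frobenius norm at most 1. It is \<infinity> unless the distribution is a finite Radon
   measure. *)
definition grad_variation ::
    "'a::euclidean_space set \<Rightarrow> 'a \<Rightarrow> 'a \<Rightarrow> ('a \<Rightarrow> 'b::euclidean_space) \<Rightarrow> ereal" where
  "grad_variation \<Omega> e1 e2 u =
     (SUP (\<phi>, \<psi>) \<in> {(\<phi>, \<psi>). \<phi> \<in> test_functions \<Omega> \<and> \<psi> \<in> test_functions \<Omega> \<and>
                        (\<forall>x. sqrt ((norm (\<phi> x))\<^sup>2 + (norm (\<psi> x))\<^sup>2) \<le> 1)}.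
        ereal (distr_deriv \<Omega> e1 u \<phi> + distr_deriv \<Omega> e2 u \<psi>))"

definition orthonormal_basis_of_plane ::
    "'a::euclidean_space \<Rightarrow> 'a \<Rightarrow> 'a set \<Rightarrow> bool" where
  "orthonormal_basis_of_plane e1 e2 P \<longleftrightarrow>
     norm e1 = 1 \<and> norm e2 = 1 \<and> orthogonal e1 e2 \<and> span {e1, e2} = P"

(* The inequality m i \<noteq> m j is needed: if m i = m j, then {m i, m j} is a singleton and as a
   set independent. *)
definition slip_normals :: "nat \<Rightarrow> (nat \<Rightarrow> 'a::euclidean_space) \<Rightarrow> bool" where
  "slip_normals N m \<longleftrightarrow>
     (\<forall>j \<in> {1..N}. m j \<noteq> 0) \<and>
     (\<forall>i \<in> {1..N}. \<forall>j \<in> {1..N}. i \<noteq> j \<longrightarrow> m i \<noteq> m j \<and> independent {m i, m j})"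

definition single_plane ::
    "'a::euclidean_space set \<Rightarrow> nat \<Rightarrow> (nat \<Rightarrow> 'a) \<Rightarrow> (nat \<Rightarrow> 'a \<Rightarrow> 'a) \<Rightarrow> bool" where
  "single_plane \<Omega> N m s \<longleftrightarrow>
     (AE x in lebesgue_on \<Omega>.
        (\<forall>j \<in> {1..N}. s j x \<in> {m j}\<^sup>\<bottom>) \<and>
        (\<forall>i \<in> {1..N}. \<forall>j \<in> {1..N}. i \<noteq> j \<longrightarrow> norm (s i x) * norm (s j x) = 0))"

end

theory Submission
  imports Defs "HOL-Library.Diagonal_Subsequence"
begin

text \<open>
  Fix two planes \<open>i \<noteq> j\<close>. The function \<open>s k i\<close> is controlled in all directions of the plane
  orthogonal to \<open>m i\<close>, uniformly in \<open>k\<close>, so it can oscillate and concentrate only along \<open>m i\<close>;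
  likewise \<open>s k j\<close> only along \<open>m j\<close>. As \<open>m i\<close> and \<open>m j\<close> are linearly independent, these two kinds
  of oscillation are decoupled, and the sequences can avoid each other pointwise only if at almost
  every point one of the limits vanishes.

  Bounded variation along \<open>w\<close> means \<open>\<integral> |u (x + w) - u x| \<le> K |w|\<close> on balls that stay inside the
  domain (\<open>translation_L1_bound\<close>). Write \<open>u\<close> and \<open>v\<close> for the two functions and truncate them to
  \<open>a = min 1 |u|\<close> and \<open>b = min 1 |v|\<close>, which obey the same bounds and satisfy \<open>a b = 0\<close>. Every
  vector is a sum \<open>w = w1 + w2\<close> with \<open>w1\<close> orthogonal to \<open>m i\<close> and \<open>w2\<close> orthogonal to \<open>m j\<close>. Replacing
  \<open>a x\<close> by \<open>a (x + w1)\<close> and \<open>b (x + w)\<close> by \<open>b (x + w1)\<close> costs \<open>O(|w|)\<close> in \<open>L\<^sup>1\<close>, so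
  \<open>\<integral> a x b (x + w) \<le> C |w|\<close> for all small \<open>w\<close> (\<open>correlation_bound\<close>). Integrating this over \<open>w\<close> shows
  that on a grid of cells of side \<open>l\<close> the averages of \<open>a\<close> and \<open>b\<close> have a product of order \<open>l\<close> in the
  mean: up to a small error, every cell carries little of \<open>a\<close> or little of \<open>b\<close>
  (\<open>finite_splitting_family\<close>). A grid admits only finitely many ways to distribute its cells, so a
  diagonal argument over finer and finer grids on a small ball yields one subsequence and one fixed
  measurable subset \<open>E\<close> of the ball such that \<open>a\<close> tends to \<open>0\<close> in \<open>L\<^sup>1\<close> on \<open>E\<close> and \<open>b\<close> tends to \<open>0\<close>
  in \<open>L\<^sup>1\<close> on the rest of the ball (\<open>complementary_vanishing_sets\<close>).

  On \<open>E\<close> the sequence \<open>u\<close> thus tends to \<open>0\<close> in measure, and a weak \<open>L\<^sup>1\<close> limit must agree with a limit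
  in measure (\<open>weak_limit_eq_0\<close>); so the weak limit of \<open>u\<close> vanishes on \<open>E\<close>, and that
  of \<open>v\<close> on the rest of the ball.
  Orthogonality to \<open>m j\<close> is a linear condition and passes to weak limits directly.
\<close>

section \<open>Smooth functions with compact support\<close>

text \<open>
  The span of these functions contains the standard flat function \<open>exp (- 1 / t)\<close>, extended by zero,
  and is closed under differentiation.
\<close>
definition flat :: "nat \<Rightarrow> real \<Rightarrow> real" where
  "flat k t = (if t > 0 then exp (- (1 / t)) / t ^ k else 0)"

lemma flat_tendsto_0: "((\<lambda>t. flat k t) \<longlongrightarrow> 0) (at 0)"
proof -
  have "((\<lambda>t. (inverse t) ^ k / exp (inverse t)) \<longlongrightarrow> (0::real)) (at_right 0)"
    by (rule filterlim_compose[OF tendsto_power_div_exp_0 filterlim_inverse_at_top_right])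
  then have "((\<lambda>t. flat k t) \<longlongrightarrow> 0) (at_right 0)"
    by (rule Lim_transform_eventually)
       (auto simp: eventually_at_right_less flat_def exp_minus field_simps
          intro: eventually_mono[OF eventually_at_right_less])
  moreover have "((\<lambda>t. flat k t) \<longlongrightarrow> 0) (at_left 0)"
    by (rule tendsto_eventually)
       (auto simp: eventually_at_left_field flat_def intro: exI[of _ "-1"])
  ultimately show ?thesis by (simp add: filterlim_split_at)
qed

lemma flat_has_derivative:
  "(flat k has_real_derivative (flat (k + 2) t - real k * flat (k + 1) t)) (at t)"
proof -
  consider "t > 0" | "t < 0" | "t = 0" by linarith
  then show ?thesis
  proof cases
    case 1
    have "((\<lambda>t. exp (- (1 / t)) / t ^ k) has_real_derivative
        (flat (k + 2) t - real k * flat (k + 1) t)) (at t)"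
      using 1 by (auto intro!: derivative_eq_intros simp: flat_def divide_simps)
         (cases k, auto simp: algebra_simps power2_eq_square)
    then show ?thesis
      by (rule has_field_derivative_transform_within_open[where S = "{0<..}"])
         (use 1 in \<open>auto simp: flat_def\<close>)
  next
    case 2
    have "((\<lambda>t. 0) has_real_derivative (flat (k + 2) t - real k * flat (k + 1) t)) (at t)"
      using 2 by (auto simp: flat_def)
    then show ?thesis
      by (rule has_field_derivative_transform_within_open[where S = "{..<0}"])
         (use 2 in \<open>auto simp: flat_def\<close>)
  next
    case 3
    have "flat (k + 1) h = (flat k (0 + h) - flat k 0) / h" for h
      by (auto simp: flat_def)
    then have "(\<lambda>h. (flat k (0 + h) - flat k 0) / h) \<midarrow>0\<rightarrow> 0"
      using flat_tendsto_0[of "k + 1"] by simp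
    then show ?thesis
      using 3 by (simp add: DERIV_def flat_def)
  qed
qed

text \<open>
  The class \<open>C_k\<close> is defined by iterated directional derivatives, so smoothness of a class of
  functions follows once the class is closed under directional derivatives. Polynomials are such a
  class.
\<close>
lemma real_polynomial_function_has_derivative:
  fixes f :: "'a::real_normed_vector \<Rightarrow> real"
  assumes "real_polynomial_function f"
  shows "\<exists>f'. (\<forall>x. (f has_derivative f' x) (at x)) \<and>
              (\<forall>v. real_polynomial_function (\<lambda>x. f' x v))"
  using assms
proof induction
  case (linear f)
  then show ?case
    by (intro exI[of _ "\<lambda>x. f"]) (auto intro: bounded_linear_imp_has_derivative)
next
  case (const c)
  then show ?case by (intro exI[of _ "\<lambda>x v. 0"]) auto
next
  case (add f g)
  then obtain f' g' where
    "\<And>x. (f has_derivative f' x) (at x)" "\<And>v. real_polynomial_function (\<lambda>x. f' x v)"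
    "\<And>x. (g has_derivative g' x) (at x)" "\<And>v. real_polynomial_function (\<lambda>x. g' x v)"
    by metis
  then show ?case
    by (intro exI[of _ "\<lambda>x v. f' x v + g' x v"]) (auto intro: has_derivative_add)
next
  case (mult f g)
  then obtain f' g' where
    "\<And>x. (f has_derivative f' x) (at x)" "\<And>v. real_polynomial_function (\<lambda>x. f' x v)"
    "\<And>x. (g has_derivative g' x) (at x)" "\<And>v. real_polynomial_function (\<lambda>x. g' x v)"
    by metis
  with mult.hyps show ?case
    by (intro exI[of _ "\<lambda>x v. f x * g' x v + f' x v * g x"]) (auto intro!: has_derivative_mult real_polynomial_function.intros(3,4))
qed

text \<open>
  For polynomial \<open>q\<close> this class contains the fields \<open>flat 0 (q x) *\<^sub>R R x\<close> with polynomial \<open>R\<close> and is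
  closed under directional derivatives; the powers in \<open>flat k\<close> and the factor \<open>r\<close> absorb the terms of
  the chain and product rules.
\<close>
inductive flat_combination ::
    "('a::euclidean_space \<Rightarrow> real) \<Rightarrow> ('a \<Rightarrow> 'b::euclidean_space) \<Rightarrow> bool"
  for q where
  zero: "flat_combination q (\<lambda>x. 0)"
| base: "real_polynomial_function r \<Longrightarrow> flat_combination q (\<lambda>x. (flat k (q x) * r x) *\<^sub>R b)"
| add: "flat_combination q f \<Longrightarrow> flat_combination q g \<Longrightarrow> flat_combination q (\<lambda>x. f x + g x)"

lemma flat_combination_has_derivative:
  assumes "flat_combination q f" and q: "real_polynomial_function q"
  shows "\<exists>f'. (\<forall>x. (f has_derivative f' x) (at x)) \<and> (\<forall>v. flat_combination q (\<lambda>x. f' x v))"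
  using assms(1)
proof induction
  case zero
  then show ?case by (intro exI[of _ "\<lambda>x v. 0"]) (auto intro: flat_combination.zero)
next
  case (add f g)
  then obtain f' g' where
    "\<And>x. (f has_derivative f' x) (at x)" "\<And>v. flat_combination q (\<lambda>x. f' x v)"
    "\<And>x. (g has_derivative g' x) (at x)" "\<And>v. flat_combination q (\<lambda>x. g' x v)"
    by metis
  then show ?case
    by (intro exI[of _ "\<lambda>x v. f' x v + g' x v"])
       (auto intro: has_derivative_add flat_combination.add)
next
  case (base r k b)
  obtain q' where q': "\<And>x. (q has_derivative q' x) (at x)"
      "\<And>v. real_polynomial_function (\<lambda>x. q' x v)"
    using real_polynomial_function_has_derivative[OF q] by metis
  obtain r' where r': "\<And>x. (r has_derivative r' x) (at x)"
      "\<And>v. real_polynomial_function (\<lambda>x. r' x v)"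
    using real_polynomial_function_has_derivative[OF base] by metis
  define D where "D x v = (flat (k + 2) (q x) * (q' x v * r x)) *\<^sub>R b
      + ((flat (k + 1) (q x) * (- real k * (q' x v * r x))) *\<^sub>R b
      + (flat k (q x) * r' x v) *\<^sub>R b)" for x v
  have "((\<lambda>x. (flat k (q x) * r x) *\<^sub>R b) has_derivative D x) (at x)" for x
  proof -
    have "((\<lambda>x. flat k (q x)) has_derivative
        (\<lambda>v. q' x v * (flat (k + 2) (q x) - real k * flat (k + 1) (q x)))) (at x)"
      using has_derivative_compose[OF q'(1)
          flat_has_derivative[unfolded has_field_derivative_def]]
      by (simp add: mult.commute)
    from has_derivative_scaleR_left[OF has_derivative_mult[OF this r'(1)], of b]
    show ?thesis
      by (rule has_derivative_eq_rhs) (auto simp: D_def fun_eq_iff algebra_simps)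
  qed
  moreover have "flat_combination q (\<lambda>x. D x v)" for v
    unfolding D_def
    by (intro flat_combination.add flat_combination.base real_polynomial_function.intros(4)
        real_polynomial_function.intros(2)[of "- real k"] base q'(2) r'(2))
  ultimately show ?case by blast
qed

lemma flat_combination_C_k:
  assumes "flat_combination q f" and q: "real_polynomial_function q"
  shows "C_k n f"
  using assms(1)
proof (induction n arbitrary: f)
  case (0 f)
  then obtain f' where "\<And>x. (f has_derivative f' x) (at x)"
    using flat_combination_has_derivative[OF _ q] by metis
  then show ?case
    by (auto intro!: continuous_at_imp_continuous_on has_derivative_continuous)
next
  case (Suc n f)
  obtain f' where f': "\<And>x. (f has_derivative f' x) (at x)" "\<And>v. flat_combination q (\<lambda>x. f' x v)"
    using flat_combination_has_derivative[OF Suc.prems q] by metis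
  have "frechet_derivative f (at x) = f' x" for x
    using frechet_derivative_at[OF f'(1)] by simp
  with f' Suc.IH show ?case
    by (auto simp: differentiable_on_def differentiable_def intro: has_derivative_at_withinI)
qed

text \<open>
  If \<open>q\<close> is positive exactly on a ball, these are test fields supported in that ball. Multiplying
  by polynomials makes the family rich enough for the Weierstrass approximation theorem.
\<close>
lemma C_k_flat_polynomial:
  assumes q: "real_polynomial_function q" and R: "polynomial_function R"
  shows "C_k n (\<lambda>x::'a::euclidean_space. flat 0 (q x) *\<^sub>R (R x :: 'b::euclidean_space))"
proof -
  have r: "real_polynomial_function (\<lambda>x. R x \<bullet> b)" for b
    using R bounded_linear_inner_left[of b] unfolding polynomial_function_def o_def by blast
  have "flat_combination q (\<lambda>x. \<Sum>b\<in>B. (flat 0 (q x) * (R x \<bullet> b)) *\<^sub>R b)" if "finite B" for B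
    using that
    by induction (auto intro!: flat_combination.zero flat_combination.add flat_combination.base r)
  from this[of Basis] have "flat_combination q (\<lambda>x. flat 0 (q x) *\<^sub>R R x)"
    by (simp add: euclidean_representation flip: scaleR_scaleR scaleR_sum_right)
  then show ?thesis using flat_combination_C_k q by blast
qed

section \<open>The \<open>L\<^sup>1\<close> norm by duality with smooth fields\<close>

text \<open>
  Support is encoded by vanishing outside \<open>S\<close>; if \<open>S\<close> is a ball whose closure lies in the domain,
  these fields are test functions there.
\<close>
definition unit_fields :: "'a::euclidean_space set \<Rightarrow> ('a \<Rightarrow> 'b::euclidean_space) set" where
  "unit_fields S = {\<phi>. (\<forall>n. C_k n \<phi>) \<and> (\<forall>x. x \<notin> S \<longrightarrow> \<phi> x = 0) \<and> (\<forall>x. norm (\<phi> x) \<le> 1)}"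

lemma unit_fields_continuous:
  assumes "\<phi> \<in> unit_fields S" shows "continuous_on A \<phi>"
  using assms C_k.simps(1)[of \<phi>] continuous_on_subset unfolding unit_fields_def by blast

text \<open>
  The sign field of \<open>g\<close> on the ball is an almost everywhere limit of continuous fields \<open>h n\<close>
  bounded by one. With the smooth cutoff \<open>\<psi>\<close>, positive on the ball, the quotient
  \<open>h n / max \<psi> (d n)\<close> is continuous on the closed ball, hence close to a polynomial \<open>R n\<close>; then
  \<open>\<psi> R n\<close> is an admissible smooth field that is as close to the sign as desired.
\<close>
lemma L1_bound_by_unit_fields:
  fixes g :: "'a::euclidean_space \<Rightarrow> 'b::euclidean_space"
  assumes g: "integrable lborel g" and "r > 0"
    and M: "\<And>\<phi>. \<phi> \<in> unit_fields (ball c r) \<Longrightarrow> (\<integral>x. g x \<bullet> \<phi> x \<partial>lborel) \<le> M"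
  shows "(\<integral>x. indicator (ball c r) x * norm (g x) \<partial>lborel) \<le> M"
proof -
  define q where "q x = r\<^sup>2 - (\<Sum>b\<in>Basis. ((x - c) \<bullet> b)\<^sup>2)" for x
  have poly_q: "real_polynomial_function q"
    unfolding q_def inner_diff_left
    by (intro real_polynomial_function_diff real_polynomial_function_sum
        real_polynomial_function_power real_polynomial_function.intros(1)
        real_polynomial_function.intros(2) bounded_linear_inner_left) auto
  have q_eq: "q x = r\<^sup>2 - (dist x c)\<^sup>2" for x
    using euclidean_inner[of "x - c" "x - c"]
    by (simp only: q_def dist_norm power2_norm_eq_inner) (simp only: power2_eq_square)
  define \<psi> where "\<psi> x = flat 0 (q x)" for x
  have \<psi>_bounds: "0 \<le> \<psi> x" "\<psi> x \<le> 1" for x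
    by (auto simp: \<psi>_def flat_def)
  have \<psi>_pos: "x \<in> ball c r \<longleftrightarrow> \<psi> x > 0" and \<psi>_zero: "x \<notin> ball c r \<Longrightarrow> \<psi> x = 0" for x
  proof -
    have "q x > 0 \<longleftrightarrow> x \<in> ball c r"
      using \<open>r > 0\<close> power_less_imp_less_base[of "dist x c" 2 r] power_strict_mono[of "dist x c" r 2]
      by (auto simp: q_eq dist_commute)
    then show "x \<in> ball c r \<longleftrightarrow> \<psi> x > 0" "x \<notin> ball c r \<Longrightarrow> \<psi> x = 0"
      by (auto simp: \<psi>_def flat_def)
  qed
  have \<psi>_cont: "continuous_on UNIV \<psi>"
    using C_k_flat_polynomial[OF poly_q polynomial_function_const[of "1::real"], of 0]
    by (simp add: \<psi>_def)
  define S where "S x = (if x \<in> ball c r then sgn (g x) else 0)" for x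
  have [measurable]: "ball c r \<in> sets borel" by simp
  have "S \<in> borel_measurable borel"
    using g unfolding S_def by measurable
  then have "S \<in> borel_measurable lebesgue"
    by (simp add: measurable_completion)
  then have "S measurable_on UNIV"
    by (simp add: lebesgue_measurable_imp_measurable_on)
  then obtain Z f where Z: "negligible Z" and f: "\<And>n. continuous_on UNIV (f n :: 'a \<Rightarrow> 'b)"
      and lim: "\<And>x. x \<notin> Z \<Longrightarrow> (\<lambda>n. f n x) \<longlonglongrightarrow> S x"
    unfolding measurable_on_def by auto
  define h where "h n x = (1 / max 1 (norm (f n x))) *\<^sub>R f n x" for n x
  have h_le: "norm (h n x) \<le> 1" for n x
    by (auto simp: h_def field_simps)
  have h_lim: "(\<lambda>n. h n x) \<longlonglongrightarrow> S x" if "x \<notin> Z" for x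
  proof -
    have "(\<lambda>n. h n x) \<longlonglongrightarrow> (1 / max 1 (norm (S x))) *\<^sub>R S x"
      unfolding h_def by (intro tendsto_intros lim that) auto
    moreover have "norm (S x) \<le> 1" by (simp add: S_def norm_sgn)
    ultimately show ?thesis by simp
  qed
  define d :: "nat \<Rightarrow> real" where "d n = inverse (real (Suc n))" for n
  have d: "d n > 0" for n by (simp add: d_def)
  have d_lim: "d \<longlonglongrightarrow> 0" unfolding d_def by (rule LIMSEQ_inverse_real_of_nat)
  have "continuous_on (cball c r) (\<lambda>x. (1 / max (\<psi> x) (d n)) *\<^sub>R h n x)" for n
    unfolding h_def using d[of n]
    by (intro continuous_intros continuous_on_subset[OF \<psi>_cont] continuous_on_subset[OF f])
       (auto simp: max_def)
  then have "\<exists>R. polynomial_function R \<and>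
      (\<forall>x\<in>cball c r. norm ((1 / max (\<psi> x) (d n)) *\<^sub>R h n x - R x) < d n)" for n
    by (intro Stone_Weierstrass_polynomial_function[OF compact_cball _ d])
  then obtain R where poly_R: "\<And>n. polynomial_function (R n)"
      and R: "\<And>n x. x \<in> cball c r \<Longrightarrow> norm ((1 / max (\<psi> x) (d n)) *\<^sub>R h n x - R n x) < d n"
    by metis
  \<comment> \<open>The factor \<open>inverse (1 + d n)\<close> compensates the approximation error in the bound by one.\<close>
  define \<phi> where "\<phi> n x = \<psi> x *\<^sub>R (inverse (1 + d n) *\<^sub>R R n x)" for n x
  have close: "norm ((\<psi> x / max (\<psi> x) (d n)) *\<^sub>R h n x - \<psi> x *\<^sub>R R n x) \<le> d n" for n x
  proof (cases "x \<in> ball c r")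
    case True
    have "norm (\<psi> x *\<^sub>R ((1 / max (\<psi> x) (d n)) *\<^sub>R h n x - R n x)) \<le> 1 * d n"
      unfolding norm_scaleR using \<psi>_bounds[of x] R[of x n] True
      by (intro mult_mono) auto
    then show ?thesis by (simp add: scaleR_diff_right)
  next
    case False
    then show ?thesis using \<psi>_zero d[of n] by simp
  qed
  have \<phi>_le: "norm (\<phi> n x) \<le> 1" for n x
  proof -
    have "norm ((\<psi> x / max (\<psi> x) (d n)) *\<^sub>R h n x) \<le> 1 * 1"
      unfolding norm_scaleR using \<psi>_bounds[of x] d[of n] h_le[of n x]
      by (intro mult_mono) (auto simp: divide_simps)
    with close[of x n] have "norm (\<psi> x *\<^sub>R R n x) \<le> 1 + d n"
      using norm_triangle_ineq4[of "(\<psi> x / max (\<psi> x) (d n)) *\<^sub>R h n x"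
          "(\<psi> x / max (\<psi> x) (d n)) *\<^sub>R h n x - \<psi> x *\<^sub>R R n x"] by simp
    then show ?thesis using d[of n] by (simp add: \<phi>_def field_simps)
  qed
  have \<phi>_unit: "\<phi> n \<in> unit_fields (ball c r)" for n
  proof -
    have "C_k k (\<phi> n)" for k
      using C_k_flat_polynomial[OF poly_q polynomial_function_cmul[OF poly_R]]
      unfolding \<phi>_def[abs_def] \<psi>_def .
    moreover have "\<phi> n x = 0" if "x \<notin> ball c r" for x
      using \<psi>_zero[OF that] by (simp add: \<phi>_def)
    ultimately show ?thesis using \<phi>_le unfolding unit_fields_def by blast
  qed
  have \<phi>_lim: "(\<lambda>n. \<phi> n x) \<longlonglongrightarrow> S x" if "x \<notin> Z" for x
  proof (cases "x \<in> ball c r")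
    case True
    then have pos: "\<psi> x > 0" using \<psi>_pos by auto
    have "(\<lambda>n. (\<psi> x / max (\<psi> x) (d n)) *\<^sub>R h n x) \<longlonglongrightarrow> (\<psi> x / max (\<psi> x) 0) *\<^sub>R S x"
      using pos by (intro tendsto_intros h_lim that d_lim) auto
    moreover have "(\<lambda>n. (\<psi> x / max (\<psi> x) (d n)) *\<^sub>R h n x - \<psi> x *\<^sub>R R n x) \<longlonglongrightarrow> 0"
      by (rule Lim_null_comparison[OF _ d_lim]) (use close in auto)
    ultimately have "(\<lambda>n. \<psi> x *\<^sub>R R n x) \<longlonglongrightarrow> S x"
      using tendsto_diff pos by fastforce
    then have "(\<lambda>n. inverse (1 + d n) *\<^sub>R (\<psi> x *\<^sub>R R n x)) \<longlonglongrightarrow> inverse (1 + 0) *\<^sub>R S x"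
      by (intro tendsto_intros d_lim) auto
    then show ?thesis by (simp add: \<phi>_def mult.commute)
  next
    case False
    then show ?thesis using \<psi>_zero by (auto simp: \<phi>_def S_def)
  qed
  have "(\<lambda>n. \<integral>x. g x \<bullet> \<phi> n x \<partial>lborel) \<longlonglongrightarrow> (\<integral>x. g x \<bullet> S x \<partial>lborel)"
  proof (rule integral_dominated_convergence[where w = "\<lambda>x. norm (g x)"])
    have "\<phi> n \<in> borel_measurable borel" for n
      using unit_fields_continuous[OF \<phi>_unit] by (rule borel_measurable_continuous_onI)
    with g show "(\<lambda>x. g x \<bullet> \<phi> n x) \<in> borel_measurable lborel" for n by measurable
    show "(\<lambda>x. g x \<bullet> S x) \<in> borel_measurable lborel"
      using g \<open>S \<in> borel_measurable borel\<close> by measurable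
    have "AE x in lborel. x \<notin> Z"
      using Z AE_not_in[of Z lebesgue]
      by (simp add: negligible_iff_null_sets AE_completion_iff)
    then show "AE x in lborel. (\<lambda>n. g x \<bullet> \<phi> n x) \<longlonglongrightarrow> g x \<bullet> S x"
      by eventually_elim (intro tendsto_intros \<phi>_lim)
    have "\<bar>g x \<bullet> \<phi> n x\<bar> \<le> norm (g x)" for n x
      using Cauchy_Schwarz_ineq2[of "g x" "\<phi> n x"] mult_left_mono[OF \<phi>_le, of "norm (g x)"]
      by (simp add: order_trans)
    then show "AE x in lborel. norm (g x \<bullet> \<phi> n x) \<le> norm (g x)" for n by simp
  qed (use g in auto)
  moreover have "g x \<bullet> S x = indicator (ball c r) x * norm (g x)" for x
    by (auto simp: S_def sgn_div_norm power2_norm_eq_inner divide_simps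
        power2_eq_square simp flip: power2_norm_eq_inner)
  ultimately show ?thesis
    using LIMSEQ_le_const2 M[OF \<phi>_unit] by fastforce
qed

section \<open>Translations and smooth fields\<close>

lemma frechet_derivative_translate:
  assumes "\<phi> differentiable (at (x - a))"
  shows "((\<lambda>x. \<phi> (x - a)) has_derivative frechet_derivative \<phi> (at (x - a))) (at x)"
proof -
  have "((\<lambda>x. x - a) has_derivative (\<lambda>h. h)) (at x)"
    by (auto intro!: derivative_eq_intros)
  then show ?thesis
    by (rule has_derivative_compose[where f = "\<lambda>x. x - a"])
       (simp add: assms flip: frechet_derivative_works)
qed

lemma C_k_translate: "C_k n \<phi> \<Longrightarrow> C_k n (\<lambda>x. \<phi> (x - a))"
proof (induction n arbitrary: \<phi>)
  case 0
  then show ?case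
    using continuous_on_compose2[of UNIV \<phi> UNIV "\<lambda>x. x - a"]
      continuous_on_diff[OF continuous_on_id continuous_on_const, of UNIV a] by simp
next
  case (Suc n)
  then have "\<phi> differentiable (at x)" for x
    by (simp add: differentiable_on_def)
  note * = frechet_derivative_translate[OF this, where a = a]
  have "frechet_derivative (\<lambda>x. \<phi> (x - a)) (at x) = frechet_derivative \<phi> (at (x - a))" for x
    by (rule frechet_derivative_at[OF *, symmetric])
  moreover have "C_k n (\<lambda>x. frechet_derivative \<phi> (at (x - a)) v)" for v
    using Suc.IH[of "\<lambda>x. frechet_derivative \<phi> (at x) v"] Suc.prems by simp
  ultimately show ?case
    using * by (auto simp: differentiable_on_def differentiable_def)
qed

lemma C_k_scaleR: "C_k n \<phi> \<Longrightarrow> C_k n (\<lambda>x. c *\<^sub>R \<phi> x)"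
proof (induction n arbitrary: \<phi>)
  case 0
  then show ?case using continuous_on_scaleR[OF continuous_on_const] by simp
next
  case (Suc n)
  then have "\<phi> differentiable (at x)" for x
    by (simp add: differentiable_on_def)
  then have *: "((\<lambda>x. c *\<^sub>R \<phi> x) has_derivative (\<lambda>v. c *\<^sub>R frechet_derivative \<phi> (at x) v)) (at x)"
    for x by (intro has_derivative_scaleR_right) (simp add: frechet_derivative_works)
  have "frechet_derivative (\<lambda>x. c *\<^sub>R \<phi> x) (at x) = (\<lambda>v. c *\<^sub>R frechet_derivative \<phi> (at x) v)" for x
    using frechet_derivative_at[OF *, symmetric] .
  moreover have "C_k n (\<lambda>x. c *\<^sub>R frechet_derivative \<phi> (at x) v)" for v
    using Suc.IH[of "\<lambda>x. frechet_derivative \<phi> (at x) v"] Suc.prems by simp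
  ultimately show ?case
    using * by (auto simp: differentiable_on_def differentiable_def)
qed

lemma unit_fields_differentiable:
  assumes "\<phi> \<in> unit_fields S"
  shows "\<phi> differentiable (at x)"
proof -
  have "C_k (Suc 0) \<phi>" using assms unfolding unit_fields_def by blast
  then show ?thesis by (simp add: differentiable_on_def)
qed

text \<open>
  Compact support bounds the derivative; it supplies the dominating function when differentiation
  and integration are interchanged.
\<close>
lemma unit_fields_derivative:
  fixes v :: "'a::euclidean_space"
  assumes \<phi>: "\<phi> \<in> unit_fields (ball c r)"
  defines "D \<equiv> (\<lambda>x. frechet_derivative \<phi> (at x) v)"
  shows "continuous_on UNIV D" "\<exists>B. \<forall>x. norm (D x) \<le> B"
proof -
  have "C_k (Suc 0) \<phi>" using \<phi> unfolding unit_fields_def by blast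
  then show cont: "continuous_on UNIV D" by (simp add: D_def)
  have zero: "D x = 0" if "x \<notin> cball c r" for x
  proof -
    have "(\<phi> has_derivative (\<lambda>_. 0)) (at x)"
      by (rule has_derivative_transform_within_open[OF has_derivative_const open_Compl[OF closed_cball]])
         (use that \<phi> in \<open>auto simp: unit_fields_def\<close>)
    then show ?thesis using frechet_derivative_at[of \<phi> "\<lambda>_. 0" x] by (simp add: D_def fun_eq_iff)
  qed
  have "compact (D ` cball c r)"
    using cont by (intro compact_continuous_image) (auto intro: continuous_on_subset)
  from compact_imp_bounded[OF this]
  obtain B where "\<forall>y \<in> D ` cball c r. norm y \<le> B" unfolding bounded_iff ..
  then have "norm (D x) \<le> max B 0" for x
    using zero[of x] by (cases "x \<in> cball c r") (auto simp: le_max_iff_disj simp del: mem_cball)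
  then show "\<exists>B. \<forall>x. norm (D x) \<le> B" by blast
qed

lemma lborel_translate:
  fixes a :: "'a::euclidean_space"
  shows "f \<in> borel_measurable borel \<Longrightarrow>
    (\<integral>x. f (x + a) \<partial>lborel) = (\<integral>x. (f x :: 'b::{banach, second_countable_topology}) \<partial>lborel)"
    "g \<in> borel_measurable borel \<Longrightarrow>
    (\<integral>\<^sup>+x. g (x + a) \<partial>lborel) = (\<integral>\<^sup>+x. g x \<partial>lborel)"
    "integrable lborel f \<Longrightarrow> integrable lborel (\<lambda>x. f (x + a))"
proof -
  show "f \<in> borel_measurable borel \<Longrightarrow> (\<integral>x. f (x + a) \<partial>lborel) = (\<integral>x. f x \<partial>lborel)"
    using integral_distr[of "(+) a" lborel borel f] by (simp add: lborel_distr_plus add.commute)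
  show "g \<in> borel_measurable borel \<Longrightarrow> (\<integral>\<^sup>+x. g (x + a) \<partial>lborel) = (\<integral>\<^sup>+x. g x \<partial>lborel)"
    using nn_integral_distr[of "(+) a" lborel borel g] by (simp add: lborel_distr_plus add.commute)
  show "integrable lborel f \<Longrightarrow> integrable lborel (\<lambda>x. f (x + a))"
    using integrable_distr[of "(+) a" lborel borel f] by (simp add: lborel_distr_plus add.commute)
qed

lemma integrable_inner_bounded:
  assumes u: "integrable lborel (u :: 'a::euclidean_space \<Rightarrow> 'b::euclidean_space)"
    and D [measurable]: "D \<in> borel_measurable borel" and B: "\<And>x. norm (D x) \<le> B"
  shows "integrable lborel (\<lambda>x. u x \<bullet> D x)"
proof (rule Bochner_Integration.integrable_bound)
  show "integrable lborel (\<lambda>x. norm (u x) * B)" using u by simp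
  have [measurable]: "u \<in> borel_measurable borel" using borel_measurable_integrable[OF u] by simp
  show "(\<lambda>x. u x \<bullet> D x) \<in> borel_measurable lborel" by measurable
  have "\<bar>u x \<bullet> D x\<bar> \<le> \<bar>norm (u x) * B\<bar>" for x
    by (rule order_trans[OF order_trans[OF Cauchy_Schwarz_ineq2 mult_left_mono[OF B norm_ge_zero]]
          abs_ge_self])
  then show "AE x in lborel. norm (u x \<bullet> D x) \<le> norm (norm (u x) * B)" by simp
qed

text \<open>
  The function \<open>t \<mapsto> \<integral> u x \<bullet> \<phi> (x - t v)\<close> has the derivative on the left of the hypothesis, by
  dominated convergence, and its increment over the unit interval is the pairing in the conclusion.
  The mean value theorem connects the two.
\<close>
lemma translation_pairing_bound:
  fixes u :: "'a::euclidean_space \<Rightarrow> 'b::euclidean_space"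
  assumes u: "integrable lborel u" and \<phi>: "\<phi> \<in> unit_fields (ball c r)"
    and M: "\<And>t. 0 \<le> t \<Longrightarrow> t \<le> 1 \<Longrightarrow>
        - (\<integral>x. u x \<bullet> frechet_derivative \<phi> (at (x - t *\<^sub>R v)) v \<partial>lborel) \<le> M"
  shows "(\<integral>x. (u (x + v) - u x) \<bullet> \<phi> x \<partial>lborel) \<le> M"
proof -
  have [measurable]: "u \<in> borel_measurable borel" using borel_measurable_integrable[OF u] by simp
  define D where "D x = frechet_derivative \<phi> (at x) v" for x
  have D_cont: "continuous_on UNIV D" and "\<exists>B. \<forall>x. norm (D x) \<le> B"
    using unit_fields_derivative[OF \<phi>] by (auto simp: D_def)
  then obtain B where B: "\<And>x. norm (D x) \<le> B" by blast
  have [measurable]: "D \<in> borel_measurable borel" "\<phi> \<in> borel_measurable borel"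
    using D_cont unit_fields_continuous[OF \<phi>] by (simp_all add: borel_measurable_continuous_onI)
  have \<phi>_le: "norm (\<phi> x) \<le> 1" for x using \<phi> by (simp add: unit_fields_def)
  have path: "((\<lambda>t. \<phi> (x - t *\<^sub>R v)) has_derivative (\<lambda>h. h *\<^sub>R (- D (x - t *\<^sub>R v)))) (at t)" for x t
  proof -
    have "linear (frechet_derivative \<phi> (at y))" for y
      using unit_fields_differentiable[OF \<phi>] by (rule linear_frechet_derivative)
    then have eq: "frechet_derivative \<phi> (at y) (- (h *\<^sub>R v)) = h *\<^sub>R (- D y)" for h y
      by (simp add: D_def linear_neg linear_cmul)
    have "((\<lambda>t. x - t *\<^sub>R v) has_derivative (\<lambda>h. - (h *\<^sub>R v))) (at t)"
      by (auto intro!: derivative_eq_intros)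
    from has_derivative_compose[OF this
        unit_fields_differentiable[OF \<phi>, unfolded frechet_derivative_works]]
    show ?thesis by (simp add: eq)
  qed
  have lip: "norm (\<phi> (x - s *\<^sub>R v) - \<phi> (x - t *\<^sub>R v)) \<le> B * \<bar>s - t\<bar>" for x s t
  proof -
    have "norm (\<phi> (x - s *\<^sub>R v) - \<phi> (x - t *\<^sub>R v)) \<le> B * norm (s - t)"
    proof (rule differentiable_bound[of UNIV "\<lambda>t. \<phi> (x - t *\<^sub>R v)"])
      show "onorm (\<lambda>h. h *\<^sub>R (- D (x - t *\<^sub>R v))) \<le> B" for t
        using B[of "x - t *\<^sub>R v"] by (intro onorm_bound) (auto simp: mult.commute[of B] mult_left_mono order_trans[OF norm_ge_zero])
    qed (use path in auto)
    then show ?thesis by simp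
  qed
  define F where "F t = (\<integral>x. u x \<bullet> \<phi> (x - t *\<^sub>R v) \<partial>lborel)" for t
  have int_\<phi>: "integrable lborel (\<lambda>x. u x \<bullet> \<phi> (x - t *\<^sub>R v))" for t
    by (rule integrable_inner_bounded[OF u _ \<phi>_le]) measurable
  have deriv: "(F has_real_derivative - (\<integral>x. u x \<bullet> D (x - t *\<^sub>R v) \<partial>lborel)) (at t)" for t
    unfolding has_field_derivative_iff tendsto_at_iff_sequentially comp_def
  proof (intro allI impI)
    fix X :: "nat \<Rightarrow> real"
    assume X: "\<forall>i. X i \<in> UNIV - {t}" "X \<longlonglongrightarrow> t"
    define Q where "Q i x = (u x \<bullet> \<phi> (x - X i *\<^sub>R v) - u x \<bullet> \<phi> (x - t *\<^sub>R v)) / (X i - t)" for i x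
    have "(\<lambda>i. \<integral>x. Q i x \<partial>lborel) \<longlonglongrightarrow> (\<integral>x. u x \<bullet> (- D (x - t *\<^sub>R v)) \<partial>lborel)"
    proof (rule integral_dominated_convergence[where w = "\<lambda>x. norm (u x) * B"])
      have "(\<lambda>i. Q i x) \<longlonglongrightarrow> u x \<bullet> (- D (x - t *\<^sub>R v))" for x
      proof -
        have "((\<lambda>s. u x \<bullet> \<phi> (x - s *\<^sub>R v)) has_real_derivative u x \<bullet> (- D (x - t *\<^sub>R v))) (at t)"
          using has_derivative_inner_right[OF path[of x t], of "u x"]
          unfolding has_field_derivative_def by (rule has_derivative_eq_rhs) (simp add: fun_eq_iff)
        then show ?thesis
          using X unfolding Q_def has_field_derivative_iff tendsto_at_iff_sequentially comp_def
          by blast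
      qed
      then show "AE x in lborel. (\<lambda>i. Q i x) \<longlonglongrightarrow> u x \<bullet> (- D (x - t *\<^sub>R v))" by simp
      have "\<bar>Q i x\<bar> \<le> norm (u x) * B" for i x
      proof -
        have "\<bar>u x \<bullet> (\<phi> (x - X i *\<^sub>R v) - \<phi> (x - t *\<^sub>R v))\<bar>
            \<le> norm (u x) * (B * \<bar>X i - t\<bar>)"
          by (rule order_trans[OF Cauchy_Schwarz_ineq2 mult_left_mono[OF lip norm_ge_zero]])
        then show ?thesis
          using X(1) by (simp add: Q_def inner_diff_right divide_le_eq mult.assoc)
      qed
      then show "AE x in lborel. norm (Q i x) \<le> norm (u x) * B" for i by simp
      show "(\<lambda>x. u x \<bullet> (- D (x - t *\<^sub>R v))) \<in> borel_measurable lborel"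
        and "(\<lambda>x. Q i x) \<in> borel_measurable lborel" for i
        unfolding Q_def by measurable
      show "integrable lborel (\<lambda>x. norm (u x) * B)" using u by simp
    qed
    moreover have "(\<integral>x. Q i x \<partial>lborel) = (F (X i) - F t) / (X i - t)" for i
      using int_\<phi> by (simp add: F_def Q_def)
    ultimately show "(\<lambda>i. (F (X i) - F t) / (X i - t)) \<longlonglongrightarrow> - (\<integral>x. u x \<bullet> D (x - t *\<^sub>R v) \<partial>lborel)"
      by simp
  qed
  obtain z where "0 < z" "z < 1" "F 1 - F 0 = - (\<integral>x. u x \<bullet> D (x - z *\<^sub>R v) \<partial>lborel)"
    using MVT2[of 0 1 F, OF _ deriv] by auto
  then have "F 1 - F 0 \<le> M" using M[of z] by (simp add: D_def)
  moreover have "(\<integral>x. u (x + v) \<bullet> \<phi> x \<partial>lborel) = F 1"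
    using lborel_translate(1)[of "\<lambda>x. u x \<bullet> \<phi> (x - v)" v] by (simp add: F_def)
  moreover have "(\<integral>x. (u (x + v) - u x) \<bullet> \<phi> x \<partial>lborel)
      = (\<integral>x. u (x + v) \<bullet> \<phi> x \<partial>lborel) - F 0"
  proof -
    have "integrable lborel (\<lambda>x. u (x + v) \<bullet> \<phi> x)"
      by (rule integrable_inner_bounded[OF lborel_translate(3)[OF u] _ \<phi>_le]) measurable
    then show ?thesis using int_\<phi>[of 0] by (simp add: F_def inner_diff_left)
  qed
  ultimately show ?thesis by simp
qed

section \<open>Translation estimates from directional variation\<close>

text \<open>
  Translations and Fubini's theorem are applied on the whole space with the Borel measure, hence a
  Borel representative that vanishes outside the domain.
\<close>
definition zero_extension ::
    "'a::euclidean_space set \<Rightarrow> ('a \<Rightarrow> 'b::euclidean_space) \<Rightarrow> ('a \<Rightarrow> 'b) \<Rightarrow> bool" where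
  "zero_extension \<Omega> s u \<longleftrightarrow> u \<in> borel_measurable borel \<and> (\<forall>x. x \<notin> \<Omega> \<longrightarrow> u x = 0) \<and>
     (AE x in lborel. x \<in> \<Omega> \<longrightarrow> u x = s x)"

lemma zero_extension_exists:
  fixes s :: "'a::euclidean_space \<Rightarrow> 'b::euclidean_space"
  assumes \<Omega>: "\<Omega> \<in> sets borel" and s: "s \<in> borel_measurable (lebesgue_on \<Omega>)"
  shows "\<exists>u. zero_extension \<Omega> s u"
proof -
  define t where "t x = indicator \<Omega> x *\<^sub>R s x" for x
  have "t \<in> borel_measurable lebesgue"
    using s \<Omega> unfolding t_def by (subst (asm) borel_measurable_restrict_space_iff) auto
  then have "\<exists>g\<in>borel_measurable lborel. AE x in lborel. t x \<bullet> b = g x" for b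
    by (intro completion_ex_borel_measurable_real) simp
  then obtain g where g: "\<And>b. g b \<in> borel_measurable lborel"
      and ae: "\<And>b. AE x in lborel. t x \<bullet> b = g b x"
    by metis
  define u where "u x = indicator \<Omega> x *\<^sub>R (\<Sum>b\<in>Basis. g b x *\<^sub>R b)" for x
  have "AE x in lborel. \<forall>b\<in>Basis. t x \<bullet> b = g b x"
    using ae by (intro AE_finite_allI) auto
  then have "AE x in lborel. x \<in> \<Omega> \<longrightarrow> u x = s x"
  proof eventually_elim
    case (elim x)
    then have "(\<Sum>b\<in>Basis. g b x *\<^sub>R b) = (\<Sum>b\<in>Basis. (t x \<bullet> b) *\<^sub>R b)" by simp
    then show ?case by (simp add: u_def t_def euclidean_representation)
  qed
  moreover have "u \<in> borel_measurable borel"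
    using g \<Omega> unfolding u_def by measurable
  ultimately show ?thesis
    unfolding zero_extension_def by (intro exI[of _ u]) (auto simp: u_def)
qed

text \<open>
  The integrand is a pointwise expression \<open>H\<close> in the function, so that the same statement serves
  pairings with a field and integrability.
\<close>
lemma zero_extension_integral:
  fixes H :: "'b::euclidean_space \<Rightarrow> 'a::euclidean_space \<Rightarrow> 'c::{banach, second_countable_topology}"
  assumes \<Omega>: "\<Omega> \<in> sets borel" and ext: "zero_extension \<Omega> s u"
    and H0: "\<And>x. H 0 x = 0"
    and meas_s: "(\<lambda>x. H (s x) x) \<in> borel_measurable (lebesgue_on \<Omega>)"
    and meas_u: "(\<lambda>x. H (u x) x) \<in> borel_measurable borel"
  shows "integrable (lebesgue_on \<Omega>) (\<lambda>x. H (s x) x) \<longleftrightarrow> integrable lborel (\<lambda>x. H (u x) x)"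
    and "(LINT x|lebesgue_on \<Omega>. H (s x) x) = (\<integral>x. H (u x) x \<partial>lborel)"
proof -
  have 1: "(\<lambda>x. indicator \<Omega> x *\<^sub>R H (s x) x) \<in> borel_measurable lebesgue"
    using meas_s \<Omega> by (subst (asm) borel_measurable_restrict_space_iff) auto
  have 2: "(\<lambda>x. H (u x) x) \<in> borel_measurable lebesgue"
    using meas_u by (simp add: measurable_completion)
  have "AE x in lborel. indicator \<Omega> x *\<^sub>R H (s x) x = H (u x) x"
    using ext unfolding zero_extension_def
    by (auto elim!: eventually_mono simp: indicator_def H0)
  then have ae: "AE x in lebesgue. indicator \<Omega> x *\<^sub>R H (s x) x = H (u x) x"
    by (simp add: AE_completion_iff)
  have "integrable (lebesgue_on \<Omega>) (\<lambda>x. H (s x) x) \<longleftrightarrow>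
      integrable lebesgue (\<lambda>x. indicator \<Omega> x *\<^sub>R H (s x) x)"
    using \<Omega> by (intro integrable_restrict_space) auto
  also have "\<dots> \<longleftrightarrow> integrable lebesgue (\<lambda>x. H (u x) x)"
    by (rule integrable_cong_AE[OF 1 2 ae])
  also have "\<dots> \<longleftrightarrow> integrable lborel (\<lambda>x. H (u x) x)"
    using meas_u by (intro integrable_completion) simp
  finally show "integrable (lebesgue_on \<Omega>) (\<lambda>x. H (s x) x) \<longleftrightarrow> integrable lborel (\<lambda>x. H (u x) x)" .
  have "(LINT x|lebesgue_on \<Omega>. H (s x) x) = (LINT x|lebesgue. indicator \<Omega> x *\<^sub>R H (s x) x)"
    using \<Omega> by (intro integral_restrict_space) auto
  also have "\<dots> = (LINT x|lebesgue. H (u x) x)"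
    by (rule integral_cong_AE[OF 1 2 ae])
  also have "\<dots> = (\<integral>x. H (u x) x \<partial>lborel)"
    using meas_u by (intro integral_completion) simp
  finally show "(LINT x|lebesgue_on \<Omega>. H (s x) x) = (\<integral>x. H (u x) x \<partial>lborel)" .
qed

lemma zero_extension_pairing:
  fixes u :: "'a::euclidean_space \<Rightarrow> 'b::euclidean_space"
  assumes \<Omega>: "\<Omega> \<in> sets borel" and ext: "zero_extension \<Omega> s u"
    and s: "s \<in> borel_measurable (lebesgue_on \<Omega>)" and D: "D \<in> borel_measurable borel"
  shows "(LINT x|lebesgue_on \<Omega>. s x \<bullet> D x) = (\<integral>x. u x \<bullet> D x \<partial>lborel)"
proof (rule zero_extension_integral(2)[OF \<Omega> ext, of "\<lambda>v x. v \<bullet> D x"])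
  have "D \<in> borel_measurable (lebesgue_on \<Omega>)"
    using D by (intro measurable_restrict_space1) (simp add: measurable_completion)
  with s show "(\<lambda>x. s x \<bullet> D x) \<in> borel_measurable (lebesgue_on \<Omega>)" by measurable
  show "(\<lambda>x. u x \<bullet> D x) \<in> borel_measurable borel"
    using ext D unfolding zero_extension_def by (intro borel_measurable_inner) auto
qed simp

lemma unit_fields_test_functions:
  assumes \<phi>: "\<phi> \<in> unit_fields (ball c r)" and sub: "cball c r \<subseteq> \<Omega>"
  shows "\<phi> \<in> test_functions \<Omega>"
proof -
  have supp: "{x. \<phi> x \<noteq> 0} \<subseteq> cball c r"
    using \<phi> ball_subset_cball unfolding unit_fields_def by blast
  then have "closure {x. \<phi> x \<noteq> 0} \<subseteq> \<Omega>"
    using closure_minimal[OF supp closed_cball] sub by blast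
  moreover have "compact (closure {x. \<phi> x \<noteq> 0})"
    using bounded_subset[OF bounded_cball supp] by simp
  ultimately show ?thesis
    using \<phi> unfolding test_functions_def unit_fields_def by blast
qed

text \<open>
  For a unit vector \<open>w = \<alpha> e1 + \<beta> e2\<close> the pair \<open>(\<alpha> \<phi>, \<beta> \<phi>)\<close> is admissible in the supremum that
  defines the variation, because \<open>\<alpha>\<^sup>2 + \<beta>\<^sup>2 = 1\<close>, and pairing with it gives the derivative in the
  direction \<open>w\<close>.
\<close>
lemma distr_deriv_le_grad_variation:
  fixes s :: "'a::euclidean_space \<Rightarrow> 'b::euclidean_space"
  assumes basis: "orthonormal_basis_of_plane e1 e2 P" and w: "w \<in> P"
    and \<Omega>: "\<Omega> \<in> sets borel" and ext: "zero_extension \<Omega> s u"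
    and s: "s \<in> borel_measurable (lebesgue_on \<Omega>)" and u: "integrable lborel u"
    and \<phi>: "\<phi> \<in> unit_fields (ball c r)" and sub: "cball c r \<subseteq> \<Omega>"
    and K: "grad_variation \<Omega> e1 e2 s \<le> ereal K"
  shows "- (\<integral>x. u x \<bullet> frechet_derivative \<phi> (at x) w \<partial>lborel) \<le> K * norm w"
proof -
  define I where "I v = (\<integral>x. u x \<bullet> frechet_derivative \<phi> (at x) v \<partial>lborel)" for v
  have meas: "(\<lambda>x. frechet_derivative \<phi> (at x) v) \<in> borel_measurable borel" for v
    using unit_fields_derivative(1)[OF \<phi>] by (rule borel_measurable_continuous_onI)
  have int: "integrable lborel (\<lambda>x. u x \<bullet> frechet_derivative \<phi> (at x) v)" for v
    using unit_fields_derivative(2)[OF \<phi>, of v] integrable_inner_bounded[OF u meas] by blast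
  have scaled: "distr_deriv \<Omega> v s (\<lambda>x. a *\<^sub>R \<phi> x) = - (a * I v)" for a v
  proof -
    have "((\<lambda>x. a *\<^sub>R \<phi> x) has_derivative (\<lambda>v. a *\<^sub>R frechet_derivative \<phi> (at x) v)) (at x)" for x
      by (rule has_derivative_scaleR_right)
         (use unit_fields_differentiable[OF \<phi>] in \<open>simp flip: frechet_derivative_works\<close>)
    from frechet_derivative_at[OF this, symmetric]
    have "distr_deriv \<Omega> v s (\<lambda>x. a *\<^sub>R \<phi> x)
        = - (LINT x|lebesgue_on \<Omega>. s x \<bullet> (a *\<^sub>R frechet_derivative \<phi> (at x) v))"
      by (simp add: distr_deriv_def)
    also have "\<dots> = - (\<integral>x. u x \<bullet> (a *\<^sub>R frechet_derivative \<phi> (at x) v) \<partial>lborel)"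
      using zero_extension_pairing[OF \<Omega> ext s, of "\<lambda>x. a *\<^sub>R frechet_derivative \<phi> (at x) v"] meas
      by simp
    finally show ?thesis by (simp add: I_def)
  qed
  have "w \<in> span {e1, e2}"
    using basis w by (simp add: orthonormal_basis_of_plane_def)
  then obtain a b where w_eq: "w = a *\<^sub>R e1 + b *\<^sub>R e2"
    by (auto simp: span_insert span_singleton) (metis add.commute diff_add_cancel)
  have norm_w: "(norm w)\<^sup>2 = a\<^sup>2 + b\<^sup>2"
    using basis by (simp add: w_eq orthonormal_basis_of_plane_def norm_add_Pythagorean
        orthogonal_clauses power_mult_distrib)
  have I_w: "I w = a * I e1 + b * I e2"
  proof -
    have "frechet_derivative \<phi> (at x) w
        = a *\<^sub>R frechet_derivative \<phi> (at x) e1 + b *\<^sub>R frechet_derivative \<phi> (at x) e2" for x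
      using linear_frechet_derivative[OF unit_fields_differentiable[OF \<phi>], of x]
      by (simp add: w_eq linear_add linear_cmul)
    then show ?thesis
      using int by (simp add: I_def inner_add_right)
  qed
  show ?thesis
  proof (cases "w = 0")
    case True
    then have "I w = 0"
      using linear_frechet_derivative[OF unit_fields_differentiable[OF \<phi>]]
      by (simp add: I_def linear_0)
    with True show ?thesis by (simp add: I_def)
  next
    case False
    define \<alpha> \<beta> where "\<alpha> = a / norm w" and "\<beta> = b / norm w"
    have "\<alpha>\<^sup>2 + \<beta>\<^sup>2 = (norm w)\<^sup>2 / (norm w)\<^sup>2"
      unfolding \<alpha>_def \<beta>_def power_divide norm_w by (rule add_divide_distrib[symmetric])
    then have unit: "\<alpha>\<^sup>2 + \<beta>\<^sup>2 = 1" using False by simp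
    have test: "(\<lambda>x. a *\<^sub>R \<phi> x) \<in> test_functions \<Omega>" if "\<bar>a\<bar> \<le> 1" for a
    proof -
      have "norm (a *\<^sub>R \<phi> x) \<le> 1 * 1" for x
        unfolding norm_scaleR using that \<phi> by (intro mult_mono) (auto simp: unit_fields_def)
      then have "(\<lambda>x. a *\<^sub>R \<phi> x) \<in> unit_fields (ball c r)"
        using \<phi> C_k_scaleR[of _ \<phi> a] by (simp add: unit_fields_def)
      then show ?thesis by (rule unit_fields_test_functions[OF _ sub])
    qed
    have "\<bar>\<alpha>\<bar> \<le> 1" "\<bar>\<beta>\<bar> \<le> 1"
      using unit abs_le_square_iff[of \<alpha> 1] abs_le_square_iff[of \<beta> 1]
        zero_le_power2[of \<alpha>] zero_le_power2[of \<beta>] by (auto simp del: zero_le_power2)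
    then have "(\<lambda>x. \<alpha> *\<^sub>R \<phi> x) \<in> test_functions \<Omega>" "(\<lambda>x. \<beta> *\<^sub>R \<phi> x) \<in> test_functions \<Omega>"
      by (simp_all add: test)
    moreover have "sqrt ((norm (\<alpha> *\<^sub>R \<phi> x))\<^sup>2 + (norm (\<beta> *\<^sub>R \<phi> x))\<^sup>2) \<le> 1" for x
    proof -
      have "(norm (\<alpha> *\<^sub>R \<phi> x))\<^sup>2 + (norm (\<beta> *\<^sub>R \<phi> x))\<^sup>2 = (\<alpha>\<^sup>2 + \<beta>\<^sup>2) * (norm (\<phi> x))\<^sup>2"
        by (simp add: power_mult_distrib algebra_simps)
      then show ?thesis using \<phi> unit by (simp add: unit_fields_def)
    qed
    ultimately have "ereal (distr_deriv \<Omega> e1 s (\<lambda>x. \<alpha> *\<^sub>R \<phi> x) + distr_deriv \<Omega> e2 s (\<lambda>x. \<beta> *\<^sub>R \<phi> x))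
        \<le> grad_variation \<Omega> e1 e2 s"
      unfolding grad_variation_def
      by (intro SUP_upper2[of "(\<lambda>x. \<alpha> *\<^sub>R \<phi> x, \<lambda>x. \<beta> *\<^sub>R \<phi> x)"]) auto
    with K have "ereal (- (\<alpha> * I e1) - \<beta> * I e2) \<le> ereal K"
      unfolding scaled by (metis add_uminus_conv_diff order_trans)
    then have "- (\<alpha> * I e1) - \<beta> * I e2 \<le> K" by simp
    then have "(- (\<alpha> * I e1) - \<beta> * I e2) * norm w \<le> K * norm w"
      by (intro mult_right_mono) auto
    moreover have "(- (\<alpha> * I e1) - \<beta> * I e2) * norm w = - I w"
      using False by (simp add: \<alpha>_def \<beta>_def I_w left_diff_distrib)
    ultimately show ?thesis by (simp add: I_def)
  qed
qed

text \<open>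
  The distributional derivative is bounded on all translates of a test field along the segment from
  \<open>0\<close> to \<open>w\<close>, since the larger ball keeps their supports inside the domain. Duality turns this into
  a bound on the \<open>L\<^sup>1\<close> norm of a difference, the form that survives truncation.
\<close>
lemma translation_L1_bound:
  fixes s :: "'a::euclidean_space \<Rightarrow> 'b::euclidean_space"
  assumes basis: "orthonormal_basis_of_plane e1 e2 P" and w: "w \<in> P"
    and \<Omega>: "\<Omega> \<in> sets borel" and ext: "zero_extension \<Omega> s u"
    and s: "s \<in> borel_measurable (lebesgue_on \<Omega>)" and u: "integrable lborel u"
    and r: "r > 0" "r + norm w \<le> R" and sub: "cball c R \<subseteq> \<Omega>"
    and K: "grad_variation \<Omega> e1 e2 s \<le> ereal K"
  shows "(\<integral>x. indicator (ball c r) x * norm (u (x + w) - u x) \<partial>lborel) \<le> K * norm w"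
proof (rule L1_bound_by_unit_fields[OF _ r(1)])
  show "integrable lborel (\<lambda>x. u (x + w) - u x)"
    using lborel_translate(3)[OF u] u by simp
  fix \<phi> :: "'a \<Rightarrow> 'b"
  assume \<phi>: "\<phi> \<in> unit_fields (ball c r)"
  show "(\<integral>x. (u (x + w) - u x) \<bullet> \<phi> x \<partial>lborel) \<le> K * norm w"
  proof (rule translation_pairing_bound[OF u \<phi>])
    fix t :: real
    assume t: "0 \<le> t" "t \<le> 1"
    define \<phi>' where "\<phi>' x = \<phi> (x - t *\<^sub>R w)" for x
    have "\<phi>' \<in> unit_fields (ball (c + t *\<^sub>R w) r)"
      using \<phi> C_k_translate[of _ \<phi> "t *\<^sub>R w"]
      unfolding unit_fields_def \<phi>'_def by (auto simp: dist_norm algebra_simps)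
    moreover have "norm (t *\<^sub>R w) \<le> norm w"
      using t by (simp add: mult_left_le_one_le)
    then have "cball (c + t *\<^sub>R w) r \<subseteq> cball c R"
      using r by (simp add: cball_subset_cball_iff dist_norm)
    moreover have "frechet_derivative \<phi> (at (x - t *\<^sub>R w)) = frechet_derivative \<phi>' (at x)" for x
      unfolding \<phi>'_def
      by (rule frechet_derivative_at[OF frechet_derivative_translate])
         (rule unit_fields_differentiable[OF \<phi>])
    ultimately show "- (\<integral>x. u x \<bullet> frechet_derivative \<phi> (at (x - t *\<^sub>R w)) w \<partial>lborel) \<le> K * norm w"
      using distr_deriv_le_grad_variation[OF basis w \<Omega> ext s u, of \<phi>' "c + t *\<^sub>R w" r K] sub K
      by simp
  qed
qed

lemma translation_nn_L1_bound:
  fixes s :: "'a::euclidean_space \<Rightarrow> 'b::euclidean_space"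
  assumes basis: "orthonormal_basis_of_plane e1 e2 P" and w: "w \<in> P"
    and \<Omega>: "\<Omega> \<in> sets borel" and ext: "zero_extension \<Omega> s u"
    and s: "s \<in> borel_measurable (lebesgue_on \<Omega>)" and u: "integrable lborel u"
    and r: "r > 0" "r + norm w \<le> R" and sub: "cball c R \<subseteq> \<Omega>"
    and K: "grad_variation \<Omega> e1 e2 s \<le> ereal K"
  shows "(\<integral>\<^sup>+x. indicator (ball c r) x * ennreal (norm (u (x + w) - u x)) \<partial>lborel) \<le> ennreal (K * norm w)"
proof -
  have "integrable lborel (\<lambda>x. norm (u (x + w) - u x))"
    using lborel_translate(3)[OF u] u by simp
  then have "integrable lborel (\<lambda>x. indicator (ball c r) x *\<^sub>R norm (u (x + w) - u x))"
    by (intro integrable_mult_indicator) auto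
  then have "(\<integral>\<^sup>+x. ennreal (indicator (ball c r) x * norm (u (x + w) - u x)) \<partial>lborel)
      = ennreal (\<integral>x. indicator (ball c r) x * norm (u (x + w) - u x) \<partial>lborel)"
    by (intro nn_integral_eq_integral) auto
  then show ?thesis
    using translation_L1_bound[OF assms] by (simp add: ennreal_mult ennreal_indicator ennreal_leI)
qed

lemma grad_variation_nonneg:
  "0 \<le> grad_variation \<Omega> e1 e2 (u :: 'a::euclidean_space \<Rightarrow> 'b::euclidean_space)"
proof -
  have "C_k n (\<lambda>_::'a. 0 :: 'b)" for n
    by (induction n) (auto simp: differentiable_on_def)
  then have "(\<lambda>_::'a. 0::'b) \<in> test_functions \<Omega>"
    by (simp add: test_functions_def)
  then have "ereal (distr_deriv \<Omega> e1 u (\<lambda>_. 0) + distr_deriv \<Omega> e2 u (\<lambda>_. 0)) \<le> grad_variation \<Omega> e1 e2 u"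
    unfolding grad_variation_def by (intro SUP_upper2[of "(\<lambda>_. 0, \<lambda>_. 0)"]) auto
  then show ?thesis by (simp add: distr_deriv_def zero_ereal_def)
qed

section \<open>Correlations on a fine grid\<close>

text \<open>
  The cells are the level sets of \<open>x \<mapsto> \<lfloor>x \<bullet> b / l\<rfloor>\<close>, restricted to \<open>S\<close>. Instead of a lower
  bound for the volume of a cell, which fails for cells cut by the boundary of \<open>S\<close>, the number of
  cells is bounded by a multiple of the inverse volume.
\<close>
lemma grid_partition:
  fixes S :: "'a::euclidean_space set"
  assumes S: "bounded S" "S \<in> sets borel"
  shows "\<exists>C. \<forall>l::real. 0 < l \<and> l \<le> 1 \<longrightarrow> (\<exists>\<P>. finite \<P> \<and> disjoint \<P> \<and> \<Union>\<P> = S \<and> \<P> \<subseteq> sets borel \<and>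
    (\<forall>Q\<in>\<P>. \<forall>x\<in>Q. \<forall>y\<in>Q. norm (y - x) \<le> DIM('a) * l) \<and> real (card \<P>) * l ^ DIM('a) \<le> C)"
proof -
  obtain L where L: "L > 0" "\<And>x. x \<in> S \<Longrightarrow> norm x \<le> L"
    using S(1) bounded_pos by blast
  have "\<exists>\<P>. finite \<P> \<and> disjoint \<P> \<and> \<Union>\<P> = S \<and> \<P> \<subseteq> sets borel \<and>
      (\<forall>Q\<in>\<P>. \<forall>x\<in>Q. \<forall>y\<in>Q. norm (y - x) \<le> DIM('a) * l) \<and>
      real (card \<P>) * l ^ DIM('a) \<le> (2 * L + 5) ^ DIM('a)"
    if l: "0 < l \<and> l \<le> 1" for l :: real
  proof -
    define M where "M = \<lceil>L / l\<rceil> + 1"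
    define \<iota> where "\<iota> x = (\<lambda>b\<in>Basis. \<lfloor>(x \<bullet> b) / l\<rfloor>)" for x :: 'a
    define Q where "Q z = {x \<in> S. \<iota> x = z}" for z
    have "\<iota> ` S \<subseteq> (\<Pi>\<^sub>E b\<in>Basis. {-M..M})"
    proof
      fix z assume "z \<in> \<iota> ` S"
      then obtain x where x: "x \<in> S" "z = \<iota> x" by blast
      have "\<lfloor>(x \<bullet> b) / l\<rfloor> \<in> {-M..M}" if "b \<in> Basis" for b
      proof -
        have "\<bar>(x \<bullet> b) / l\<bar> \<le> L / l"
          using Basis_le_norm[OF that, of x] L(2)[OF x(1)] l by (simp add: divide_right_mono)
        then show ?thesis unfolding M_def atLeastAtMost_iff by linarith
      qed
      then show "z \<in> (\<Pi>\<^sub>E b\<in>Basis. {-M..M})" by (auto simp: x(2) \<iota>_def)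
    qed
    moreover have fin: "finite (\<Pi>\<^sub>E b\<in>(Basis::'a set). {-M..M})" by (intro finite_PiE) auto
    ultimately have fin_im: "finite (\<iota> ` S)" and card_le: "card (\<iota> ` S) \<le> card (\<Pi>\<^sub>E b\<in>(Basis::'a set). {-M..M})"
      by (auto intro: finite_subset card_mono)
    have "0 < L / l" using L(1) l by simp
    then have "M \<ge> 0" unfolding M_def by linarith
    have M_le: "real_of_int M \<le> L / l + 2" unfolding M_def by linarith
    have "real (card (Q ` \<iota> ` S)) \<le> real (card (\<iota> ` S))"
      using card_image_le[OF fin_im] by simp
    also have "\<dots> \<le> real (card {-M..M} ^ DIM('a))"
      using card_le by (simp add: card_PiE)
    also have "\<dots> = (2 * real_of_int M + 1) ^ DIM('a)"
      using \<open>M \<ge> 0\<close> by simp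
    finally have "real (card (Q ` \<iota> ` S)) * l ^ DIM('a) \<le> (2 * real_of_int M + 1) ^ DIM('a) * l ^ DIM('a)"
      using l by (intro mult_right_mono) auto
    also have "\<dots> = ((2 * real_of_int M + 1) * l) ^ DIM('a)" by (simp add: power_mult_distrib)
    also have "\<dots> \<le> (2 * L + 5) ^ DIM('a)"
    proof (rule power_mono)
      have "(2 * real_of_int M + 1) * l \<le> (2 * (L / l + 2) + 1) * l"
        using M_le l by (intro mult_right_mono) auto
      also have "\<dots> \<le> 2 * L + 5" using l by (simp add: field_simps)
      finally show "(2 * real_of_int M + 1) * l \<le> 2 * L + 5" .
    qed (use \<open>M \<ge> 0\<close> l in auto)
    finally have card: "real (card (Q ` \<iota> ` S)) * l ^ DIM('a) \<le> (2 * L + 5) ^ DIM('a)" .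
    have diam: "norm (y - x) \<le> DIM('a) * l" if "x \<in> Q z" "y \<in> Q z" for x y z
    proof -
      have "\<bar>(y - x) \<bullet> b\<bar> \<le> l" if b: "b \<in> Basis" for b
      proof -
        have "\<iota> x b = \<iota> y b" using \<open>x \<in> Q z\<close> \<open>y \<in> Q z\<close> by (simp add: Q_def)
        then have "\<lfloor>(x \<bullet> b) / l\<rfloor> = \<lfloor>(y \<bullet> b) / l\<rfloor>" using b by (simp add: \<iota>_def)
        then have "\<bar>(y \<bullet> b) / l - (x \<bullet> b) / l\<bar> \<le> 1" by linarith
        then have "\<bar>((y - x) \<bullet> b) / l\<bar> \<le> 1" by (simp add: inner_diff_left diff_divide_distrib)
        then show ?thesis using l by (simp add: divide_le_eq)
      qed
      then have "(\<Sum>b\<in>Basis. \<bar>(y - x) \<bullet> b\<bar>) \<le> DIM('a) * l"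
        using sum_bounded_above[of Basis "\<lambda>b. \<bar>(y - x) \<bullet> b\<bar>" l] by simp
      then show ?thesis using norm_le_l1[of "y - x"] by linarith
    qed
    have meas: "Q z \<in> sets borel" for z
    proof (cases "z \<in> \<iota> ` S")
      case True
      then have z: "\<And>b. b \<notin> Basis \<Longrightarrow> z b = undefined" by (auto simp: \<iota>_def)
      have "Q z = {x \<in> S. \<forall>b\<in>Basis. \<lfloor>(x \<bullet> b) / l\<rfloor> = z b}"
        using z by (auto simp: Q_def \<iota>_def fun_eq_iff restrict_def)
      also have "\<dots> \<in> sets borel"
        using S(2) by measurable
      finally show ?thesis .
    next
      case False
      then have "Q z = {}" by (auto simp: Q_def)
      then show ?thesis by simp
    qed
    show ?thesis
    proof (intro exI[of _ "Q ` \<iota> ` S"] conjI)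
      show "disjoint (Q ` \<iota> ` S)" by (auto simp: disjoint_def Q_def)
      show "\<Union> (Q ` \<iota> ` S) = S" by (auto simp: Q_def)
    qed (use fin_im meas diam card in auto)
  qed
  then show ?thesis by blast
qed

text \<open>
  A product of integrals over the same cell is a double integral over pairs of points at distance
  at most \<open>\<rho>\<close>. The substitution \<open>y = x + w\<close> and Fubini's theorem turn the sum over the cells into
  an average of correlations over \<open>w\<close>.
\<close>
lemma partition_correlation_bound:
  fixes a b :: "'a::euclidean_space \<Rightarrow> ennreal"
  assumes [measurable]: "a \<in> borel_measurable borel" "b \<in> borel_measurable borel" "S \<in> sets borel"
    and \<P>: "finite \<P>" "disjoint \<P>" "\<Union>\<P> \<subseteq> S" "\<P> \<subseteq> sets borel"
    and diam: "\<And>Q x y. Q \<in> \<P> \<Longrightarrow> x \<in> Q \<Longrightarrow> y \<in> Q \<Longrightarrow> norm (y - x) \<le> \<rho>"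
    and M: "\<And>w. norm w \<le> \<rho> \<Longrightarrow> (\<integral>\<^sup>+x. indicator S x * (a x * b (x + w)) \<partial>lborel) \<le> M"
  shows "(\<Sum>Q\<in>\<P>. (\<integral>\<^sup>+x. indicator Q x * a x \<partial>lborel) * (\<integral>\<^sup>+x. indicator Q x * b x \<partial>lborel))
    \<le> M * emeasure lborel (cball (0::'a) \<rho>)"
proof -
  have Q: "Q \<in> sets borel" if "Q \<in> \<P>" for Q using \<P>(4) that by blast
  have [measurable]: "cball (0::'a) \<rho> \<in> sets borel" by simp
  have pointwise: "(\<Sum>Q\<in>\<P>. indicator Q x * indicator Q y :: ennreal)
      \<le> indicator S x * indicator (cball 0 \<rho>) (y - x)" for x y
  proof (cases "\<exists>Q\<in>\<P>. x \<in> Q \<and> y \<in> Q")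
    case True
    then obtain Q where Q: "Q \<in> \<P>" "x \<in> Q" "y \<in> Q" by blast
    have "x \<notin> Q'" if "Q' \<in> \<P> - {Q}" for Q'
      using that Q \<P>(2) by (auto simp: disjoint_def)
    then have "(\<Sum>Q\<in>\<P>. indicator Q x * indicator Q y :: ennreal) = indicator Q x * indicator Q y"
      using \<P>(1) Q(1) by (subst sum.remove[OF _ Q(1)]) (auto intro!: sum.neutral)
    also have "\<dots> \<le> indicator S x * indicator (cball 0 \<rho>) (y - x)"
      using Q \<P>(3) diam[OF Q] by (auto simp: indicator_def)
    finally show ?thesis .
  next
    case False
    then have "(\<Sum>Q\<in>\<P>. indicator Q x * indicator Q y :: ennreal) = 0"
      by (intro sum.neutral) (auto simp: indicator_def)
    then show ?thesis by simp
  qed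
  have "(\<Sum>Q\<in>\<P>. (\<integral>\<^sup>+x. indicator Q x * a x \<partial>lborel) * (\<integral>\<^sup>+y. indicator Q y * b y \<partial>lborel))
      = (\<Sum>Q\<in>\<P>. \<integral>\<^sup>+x. \<integral>\<^sup>+y. indicator Q x * indicator Q y * (a x * b y) \<partial>lborel \<partial>lborel)"
  proof (rule sum.cong[OF refl])
    fix Q assume "Q \<in> \<P>"
    note Q[OF this, measurable]
    have "(\<integral>\<^sup>+x. indicator Q x * a x \<partial>lborel) * (\<integral>\<^sup>+y. indicator Q y * b y \<partial>lborel)
        = (\<integral>\<^sup>+x. indicator Q x * a x * (\<integral>\<^sup>+y. indicator Q y * b y \<partial>lborel) \<partial>lborel)"
      by (rule nn_integral_multc[symmetric]) measurable
    also have "\<dots> = (\<integral>\<^sup>+x. \<integral>\<^sup>+y. indicator Q x * a x * (indicator Q y * b y) \<partial>lborel \<partial>lborel)"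
      by (intro nn_integral_cong nn_integral_cmult[symmetric]) measurable
    finally show "(\<integral>\<^sup>+x. indicator Q x * a x \<partial>lborel) * (\<integral>\<^sup>+y. indicator Q y * b y \<partial>lborel)
        = (\<integral>\<^sup>+x. \<integral>\<^sup>+y. indicator Q x * indicator Q y * (a x * b y) \<partial>lborel \<partial>lborel)"
      by (simp add: mult_ac)
  qed
  also have "\<dots> = (\<integral>\<^sup>+x. (\<Sum>Q\<in>\<P>. \<integral>\<^sup>+y. indicator Q x * indicator Q y * (a x * b y) \<partial>lborel) \<partial>lborel)"
  proof (rule nn_integral_sum[symmetric])
    fix Q assume "Q \<in> \<P>"
    note Q[OF this, measurable]
    show "(\<lambda>x. \<integral>\<^sup>+y. indicator Q x * indicator Q y * (a x * b y) \<partial>lborel) \<in> borel_measurable lborel"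
      by measurable
  qed
  also have "\<dots> = (\<integral>\<^sup>+x. \<integral>\<^sup>+y. (\<Sum>Q\<in>\<P>. indicator Q x * indicator Q y * (a x * b y)) \<partial>lborel \<partial>lborel)"
  proof (intro nn_integral_cong nn_integral_sum[symmetric])
    fix Q x assume "Q \<in> \<P>"
    note Q[OF this, measurable]
    show "(\<lambda>y. indicator Q x * indicator Q y * (a x * b y)) \<in> borel_measurable lborel"
      by measurable
  qed
  also have "\<dots> \<le> (\<integral>\<^sup>+x. \<integral>\<^sup>+y. indicator S x * indicator (cball 0 \<rho>) (y - x) * (a x * b y) \<partial>lborel \<partial>lborel)"
    unfolding sum_distrib_right[symmetric]
    by (intro nn_integral_mono mult_right_mono pointwise) simp
  also have "\<dots> = (\<integral>\<^sup>+x. \<integral>\<^sup>+w. indicator S x * indicator (cball 0 \<rho>) w * (a x * b (x + w)) \<partial>lborel \<partial>lborel)"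
  proof (rule nn_integral_cong)
    fix x :: 'a
    have "(\<integral>\<^sup>+w. indicator S x * indicator (cball 0 \<rho>) (w + x - x) * (a x * b (w + x)) \<partial>lborel)
        = (\<integral>\<^sup>+y. indicator S x * indicator (cball 0 \<rho>) (y - x) * (a x * b y) \<partial>lborel)"
      by (rule lborel_translate(2)) measurable
    then show "(\<integral>\<^sup>+y. indicator S x * indicator (cball 0 \<rho>) (y - x) * (a x * b y) \<partial>lborel)
        = (\<integral>\<^sup>+w. indicator S x * indicator (cball 0 \<rho>) w * (a x * b (x + w)) \<partial>lborel)"
      by (simp add: add.commute)
  qed
  also have "\<dots> = (\<integral>\<^sup>+w. \<integral>\<^sup>+x. indicator S x * indicator (cball 0 \<rho>) w * (a x * b (x + w)) \<partial>lborel \<partial>lborel)"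
    by (rule lborel_pair.Fubini'[symmetric]) measurable
  also have "\<dots> = (\<integral>\<^sup>+w. indicator (cball 0 \<rho>) w * (\<integral>\<^sup>+x. indicator S x * (a x * b (x + w)) \<partial>lborel) \<partial>lborel)"
    by (subst nn_integral_cmult[symmetric]) (auto simp: mult_ac)
  also have "\<dots> \<le> (\<integral>\<^sup>+w. M * indicator (cball (0::'a) \<rho>) w \<partial>lborel)"
    using M by (intro nn_integral_mono) (auto simp: indicator_def)
  also have "\<dots> = M * emeasure lborel (cball (0::'a) \<rho>)"
    by (simp add: nn_integral_cmult_indicator)
  finally show ?thesis .
qed

section \<open>Complementary sets on which the truncations vanish\<close>

lemma nn_integral_Union_le:
  assumes "finite \<G>" "\<G> \<subseteq> sets M" "f \<in> borel_measurable M" "A \<subseteq> \<Union>\<G>"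
  shows "(\<integral>\<^sup>+x. indicator A x * f x \<partial>M) \<le> (\<Sum>Q\<in>\<G>. \<integral>\<^sup>+x. indicator Q x * f x \<partial>M)"
proof -
  have "indicator A x * f x \<le> (\<Sum>Q\<in>\<G>. indicator Q x * f x)" for x
  proof (cases "x \<in> A")
    case True
    then obtain Q where "Q \<in> \<G>" "x \<in> Q" using assms(4) by blast
    then have "indicator A x * f x = indicator Q x * f x" using True by simp
    also have "\<dots> \<le> (\<Sum>Q\<in>\<G>. indicator Q x * f x)"
      using \<open>Q \<in> \<G>\<close> assms(1) by (intro member_le_sum) auto
    finally show ?thesis .
  qed simp
  then have "(\<integral>\<^sup>+x. indicator A x * f x \<partial>M) \<le> (\<integral>\<^sup>+x. (\<Sum>Q\<in>\<G>. indicator Q x * f x) \<partial>M)"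
    by (intro nn_integral_mono)
  also have "\<dots> = (\<Sum>Q\<in>\<G>. \<integral>\<^sup>+x. indicator Q x * f x \<partial>M)"
  proof (rule nn_integral_sum)
    fix Q assume "Q \<in> \<G>"
    then have "Q \<in> sets M" using assms(2) by blast
    then show "(\<lambda>x. indicator Q x * f x) \<in> borel_measurable M" using assms(3) by measurable
  qed
  finally show ?thesis .
qed

text \<open>
  Collect in \<open>A\<close> the grid cells on which the integral of \<open>a\<close> is at most \<open>\<theta>\<close>. The number of cells
  bounds the integral of \<open>a\<close> over \<open>A\<close>; on the other cells, the correlation bound divided by \<open>\<theta>\<close>
  bounds the integral of \<open>b\<close>. The latter is of order \<open>l / \<epsilon>\<close> for cells of side \<open>l\<close>, because the
  volume of a ball of radius comparable to \<open>l\<close> cancels against the number of cells. The sets \<open>A\<close>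
  are unions of cells, so the family is finite and independent of \<open>a\<close> and \<open>b\<close>; this is what
  permits the passage to subsequences.
\<close>
lemma finite_splitting_family:
  fixes S :: "'a::euclidean_space set"
  assumes S: "bounded S" "S \<in> sets borel" and pos: "\<rho> > 0" "\<epsilon> > 0" "K \<ge> 0"
  shows "\<exists>\<A>. finite \<A> \<and> \<A> \<subseteq> sets borel \<and> (\<forall>A\<in>\<A>. A \<subseteq> S) \<and>
    (\<forall>a b. a \<in> borel_measurable borel \<longrightarrow> b \<in> borel_measurable borel \<longrightarrow>
      (\<forall>w. norm w \<le> \<rho> \<longrightarrow> (\<integral>\<^sup>+x. indicator S x * (a x * b (x + w)) \<partial>lborel) \<le> ennreal (K * norm w)) \<longrightarrow>
      (\<exists>A\<in>\<A>. (\<integral>\<^sup>+x. indicator A x * a x \<partial>lborel) \<le> ennreal \<epsilon> \<and>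
              (\<integral>\<^sup>+x. indicator (S - A) x * b x \<partial>lborel) \<le> ennreal \<epsilon>))"
proof -
  from grid_partition[OF S] obtain C where C: "\<forall>l::real. 0 < l \<and> l \<le> 1 \<longrightarrow> (\<exists>\<P>. finite \<P> \<and>
    disjoint \<P> \<and> \<Union>\<P> = S \<and> \<P> \<subseteq> sets borel \<and>
    (\<forall>Q\<in>\<P>. \<forall>x\<in>Q. \<forall>y\<in>Q. norm (y - x) \<le> DIM('a) * l) \<and> real (card \<P>) * l ^ DIM('a) \<le> C)" ..
  have "C \<ge> 0"
  proof -
    obtain \<P> :: "'a set set" where "real (card \<P>) * 1 ^ DIM('a) \<le> C"
      using C[rule_format, of 1] by auto
    then show ?thesis by (simp add: order_trans[OF of_nat_0_le_iff])
  qed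
  define B where "B = K * DIM('a) * (unit_ball_vol DIM('a) * DIM('a) ^ DIM('a))"
  have "B \<ge> 0" using pos by (simp add: B_def)
  \<comment> \<open>The last entry makes the correlation bound on the remaining cells at most \<open>\<theta> * \<epsilon>\<close>.\<close>
  define l where "l = min 1 (min (\<rho> / DIM('a)) (\<epsilon>\<^sup>2 / ((B + 1) * (C + 1))))"
  have l: "0 < l" "l \<le> 1" "DIM('a) * l \<le> \<rho>" "l \<le> \<epsilon>\<^sup>2 / ((B + 1) * (C + 1))"
  proof -
    show "0 < l" using pos \<open>B \<ge> 0\<close> \<open>C \<ge> 0\<close> by (simp add: l_def)
    have "l \<le> \<rho> / DIM('a)" by (simp add: l_def)
    then show "DIM('a) * l \<le> \<rho>" by (simp add: pos_le_divide_eq mult.commute)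
  qed (simp_all add: l_def)
  obtain \<P> where \<P>: "finite \<P>" "disjoint \<P>" "\<Union>\<P> = S" "\<P> \<subseteq> sets borel"
    and diam: "\<And>Q x y. Q \<in> \<P> \<Longrightarrow> x \<in> Q \<Longrightarrow> y \<in> Q \<Longrightarrow> norm (y - x) \<le> DIM('a) * l"
    and card: "real (card \<P>) * l ^ DIM('a) \<le> C"
    using C[rule_format, of l] l(1,2) by blast
  define \<theta> where "\<theta> = \<epsilon> * l ^ DIM('a) / (C + 1)"
  have "\<theta> > 0" using pos l \<open>C \<ge> 0\<close> by (simp add: \<theta>_def)
  have few: "real (card \<P>) * \<theta> \<le> \<epsilon>"
  proof -
    have "real (card \<P>) * \<theta> = \<epsilon> * (real (card \<P>) * l ^ DIM('a)) / (C + 1)" by (simp add: \<theta>_def)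
    also have "\<dots> \<le> \<epsilon> * (C + 1) / (C + 1)"
      using card \<open>C \<ge> 0\<close> pos by (intro divide_right_mono mult_left_mono) auto
    finally show ?thesis using \<open>C \<ge> 0\<close> by simp
  qed
  have scale: "B * l * l ^ DIM('a) \<le> \<theta> * \<epsilon>"
  proof -
    have "B * l \<le> (B + 1) * (\<epsilon>\<^sup>2 / ((B + 1) * (C + 1)))"
      using l \<open>B \<ge> 0\<close> by (intro mult_mono) auto
    also have "\<dots> = \<epsilon>\<^sup>2 / (C + 1)" using \<open>B \<ge> 0\<close> by simp
    finally have "B * l * l ^ DIM('a) \<le> \<epsilon>\<^sup>2 / (C + 1) * l ^ DIM('a)"
      using l by (intro mult_right_mono) auto
    then show ?thesis by (simp add: \<theta>_def power2_eq_square mult_ac)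
  qed
  show ?thesis
  proof (intro exI[of _ "Union ` Pow \<P>"] conjI allI impI)
    show "finite (Union ` Pow \<P>)" using \<P>(1) by simp
    show "Union ` Pow \<P> \<subseteq> sets borel"
    proof
      fix A assume "A \<in> Union ` Pow \<P>"
      then obtain \<G> where "A = \<Union>\<G>" "\<G> \<subseteq> \<P>" by blast
      then show "A \<in> sets borel"
        using \<P>(1,4) finite_subset by (auto intro!: sets.finite_Union)
    qed
    show "\<forall>A\<in>Union ` Pow \<P>. A \<subseteq> S" using \<P>(3) by auto
    fix a b :: "'a \<Rightarrow> ennreal"
    assume meas: "a \<in> borel_measurable borel" "b \<in> borel_measurable borel"
      and corr: "\<forall>w. norm w \<le> \<rho> \<longrightarrow>
        (\<integral>\<^sup>+x. indicator S x * (a x * b (x + w)) \<partial>lborel) \<le> ennreal (K * norm w)"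
    define \<G> where "\<G> = {Q \<in> \<P>. (\<integral>\<^sup>+x. indicator Q x * a x \<partial>lborel) \<le> ennreal \<theta>}"
    have \<G>: "\<G> \<subseteq> \<P>" "finite \<G>" "\<G> \<subseteq> sets lborel" "finite (\<P> - \<G>)" "\<P> - \<G> \<subseteq> sets lborel"
      using \<P> by (auto simp: \<G>_def)
    have "(\<integral>\<^sup>+x. indicator (\<Union>\<G>) x * a x \<partial>lborel) \<le> (\<Sum>Q\<in>\<G>. \<integral>\<^sup>+x. indicator Q x * a x \<partial>lborel)"
      using meas by (intro nn_integral_Union_le \<G>) auto
    also have "\<dots> \<le> (\<Sum>Q\<in>\<G>. ennreal \<theta>)" by (intro sum_mono) (simp add: \<G>_def)
    also have "\<dots> = ennreal (real (card \<G>) * \<theta>)"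
      using \<open>\<theta> > 0\<close> by (simp add: ennreal_mult flip: ennreal_of_nat_eq_real_of_nat)
    also have "\<dots> \<le> ennreal (real (card \<P>) * \<theta>)"
      using \<open>\<theta> > 0\<close> card_mono[OF \<P>(1) \<G>(1)] by (intro ennreal_leI mult_right_mono) auto
    also have "\<dots> \<le> ennreal \<epsilon>" using few by (rule ennreal_leI)
    finally have small_a: "(\<integral>\<^sup>+x. indicator (\<Union>\<G>) x * a x \<partial>lborel) \<le> ennreal \<epsilon>" .
    have "ennreal \<theta> * (\<Sum>Q\<in>\<P> - \<G>. \<integral>\<^sup>+x. indicator Q x * b x \<partial>lborel)
        \<le> (\<Sum>Q\<in>\<P> - \<G>. (\<integral>\<^sup>+x. indicator Q x * a x \<partial>lborel) * (\<integral>\<^sup>+x. indicator Q x * b x \<partial>lborel))"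
      unfolding sum_distrib_left by (intro sum_mono mult_right_mono) (auto simp: \<G>_def)
    also have "\<dots> \<le> (\<Sum>Q\<in>\<P>. (\<integral>\<^sup>+x. indicator Q x * a x \<partial>lborel) * (\<integral>\<^sup>+x. indicator Q x * b x \<partial>lborel))"
      using \<P>(1) by (intro sum_mono2) auto
    also have "\<dots> \<le> ennreal (K * (DIM('a) * l)) * emeasure lborel (cball (0::'a) (DIM('a) * l))"
    proof (rule partition_correlation_bound[OF meas S(2) \<P>(1,2) _ \<P>(4) diam])
      fix w :: 'a assume w: "norm w \<le> DIM('a) * l"
      then have "(\<integral>\<^sup>+x. indicator S x * (a x * b (x + w)) \<partial>lborel) \<le> ennreal (K * norm w)"
        using corr l(3) by auto
      also have "\<dots> \<le> ennreal (K * (DIM('a) * l))"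
        using w pos by (intro ennreal_leI mult_left_mono) auto
      finally show "(\<integral>\<^sup>+x. indicator S x * (a x * b (x + w)) \<partial>lborel) \<le> ennreal (K * (DIM('a) * l))" .
    qed (use \<P>(3) in auto)
    also have "\<dots> = ennreal (B * l * l ^ DIM('a))"
      using l(1) pos by (simp add: emeasure_cball B_def power_mult_distrib mult_ac flip: ennreal_mult)
    also have "\<dots> \<le> ennreal \<theta> * ennreal \<epsilon>"
      using scale \<open>\<theta> > 0\<close> pos by (simp add: ennreal_leI flip: ennreal_mult)
    finally have "(\<Sum>Q\<in>\<P> - \<G>. \<integral>\<^sup>+x. indicator Q x * b x \<partial>lborel) \<le> ennreal \<epsilon>"
      using \<open>\<theta> > 0\<close> by (simp add: ennreal_mult_le_mult_iff)
    moreover have "(\<integral>\<^sup>+x. indicator (S - \<Union>\<G>) x * b x \<partial>lborel)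
        \<le> (\<Sum>Q\<in>\<P> - \<G>. \<integral>\<^sup>+x. indicator Q x * b x \<partial>lborel)"
      using meas \<P>(3) by (intro nn_integral_Union_le \<G>) auto
    ultimately show "\<exists>A\<in>Union ` Pow \<P>. (\<integral>\<^sup>+x. indicator A x * a x \<partial>lborel) \<le> ennreal \<epsilon> \<and>
        (\<integral>\<^sup>+x. indicator (S - A) x * b x \<partial>lborel) \<le> ennreal \<epsilon>"
      using small_a \<G>(1) by (intro bexI[of _ "\<Union>\<G>"]) auto
  qed
qed

lemma pigeonhole_subsequence:
  assumes "finite \<A>" "\<And>k::nat. \<exists>A\<in>\<A>. P A k"
  shows "\<exists>r::nat \<Rightarrow> nat. strict_mono r \<and> (\<exists>A\<in>\<A>. \<forall>k. P A (r k))"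
proof -
  obtain f where f: "\<And>k. f k \<in> \<A>" "\<And>k. P (f k) k" using assms(2) by metis
  have "finite (range f)" using f(1) assms(1) by (meson finite_subset image_subsetI)
  then obtain k where inf: "infinite {j. f j = f k}"
    using pigeonhole_infinite[of UNIV f] by auto
  then have "P (f k) (enumerate {j. f j = f k} n)" for n
    using enumerate_in_set[OF inf, of n] f(2) by (metis mem_Collect_eq)
  then show ?thesis
    using f(1) strict_mono_enumerate[OF inf] by blast
qed

text \<open>
  For each scale \<open>(1/2) ^ n\<close> finitely many sets suffice, so one of them works for infinitely many
  indices. Diagonalising over \<open>n\<close> freezes all the sets at once.
\<close>
lemma diagonal_splitting:
  fixes S :: "'a::euclidean_space set" and a b :: "nat \<Rightarrow> 'a \<Rightarrow> ennreal"
  assumes S: "bounded S" "S \<in> sets borel" and pos: "\<rho> > 0" "K \<ge> 0"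
    and meas: "\<And>k. a k \<in> borel_measurable borel" "\<And>k. b k \<in> borel_measurable borel"
    and corr: "\<And>k w. norm w \<le> \<rho> \<Longrightarrow>
        (\<integral>\<^sup>+x. indicator S x * (a k x * b k (x + w)) \<partial>lborel) \<le> ennreal (K * norm w)"
  shows "\<exists>(r::nat \<Rightarrow> nat) A. strict_mono r \<and> (\<forall>n. A n \<in> sets borel \<and> A n \<subseteq> S \<and>
    (\<forall>k\<ge>n. (\<integral>\<^sup>+x. indicator (A n) x * a (r k) x \<partial>lborel) \<le> ennreal ((1/2) ^ n) \<and>
            (\<integral>\<^sup>+x. indicator (S - A n) x * b (r k) x \<partial>lborel) \<le> ennreal ((1/2) ^ n)))"
proof -
  define good where "good n A k \<longleftrightarrow> A \<in> sets borel \<and> A \<subseteq> S \<and>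
    (\<integral>\<^sup>+x. indicator A x * a k x \<partial>lborel) \<le> ennreal ((1/2) ^ n) \<and>
    (\<integral>\<^sup>+x. indicator (S - A) x * b k x \<partial>lborel) \<le> ennreal ((1/2) ^ n)" for n A k
  have family: "\<exists>\<A>. finite \<A> \<and> (\<forall>k. \<exists>A\<in>\<A>. good n A k)" for n
  proof -
    have "(1/2 :: real) ^ n > 0" by simp
    from finite_splitting_family[OF S pos(1) this pos(2)] obtain \<A> where
      \<A>: "finite \<A>" "\<A> \<subseteq> sets borel" "\<forall>A\<in>\<A>. A \<subseteq> S" and split: "\<forall>a b. a \<in> borel_measurable borel \<longrightarrow> b \<in> borel_measurable borel \<longrightarrow>
      (\<forall>w. norm w \<le> \<rho> \<longrightarrow> (\<integral>\<^sup>+x. indicator S x * (a x * b (x + w)) \<partial>lborel) \<le> ennreal (K * norm w)) \<longrightarrow>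
      (\<exists>A\<in>\<A>. (\<integral>\<^sup>+x. indicator A x * a x \<partial>lborel) \<le> ennreal ((1/2) ^ n) \<and>
              (\<integral>\<^sup>+x. indicator (S - A) x * b x \<partial>lborel) \<le> ennreal ((1/2) ^ n))"
      by (elim exE conjE)
    have "\<exists>A\<in>\<A>. good n A k" for k
      using split[rule_format, OF meas corr, of k] \<A>(2,3) unfolding good_def by blast
    with \<A>(1) show ?thesis by blast
  qed
  interpret subseqs "\<lambda>n s. \<exists>A. \<forall>k. good n A (s k)"
  proof
    fix n and s :: "nat \<Rightarrow> nat"
    obtain \<A> where "finite \<A>" "\<forall>k. \<exists>A\<in>\<A>. good n A k" using family by blast
    then obtain r' :: "nat \<Rightarrow> nat" and A where "strict_mono r'" "\<forall>k. good n A (s (r' k))"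
      using pigeonhole_subsequence[of \<A> "\<lambda>A k. good n A (s k)"] by auto
    then show "\<exists>r'::nat \<Rightarrow> nat. strict_mono r' \<and> (\<exists>A. \<forall>k. good n A ((s \<circ> r') k))"
      unfolding o_def by (intro exI[of _ r'] exI[of _ A] conjI)
  qed
  have "\<exists>A. \<forall>k. good n A ((diagseq \<circ> (+) (Suc n)) k)" for n
    by (rule diagseq_holds) (auto simp: o_def)
  then obtain A where A: "\<And>n k. good n (A n) (diagseq (Suc n + k))"
    by (auto simp: o_def) metis
  have "good n (A n) (diagseq (Suc k))" if "n \<le> k" for n k
    using A[of n "k - n"] that by simp
  moreover have "strict_mono (\<lambda>k. diagseq (Suc k))"
    using subseq_diagseq by (simp add: strict_mono_def)
  ultimately show ?thesis
  proof (intro exI[of _ "\<lambda>k. diagseq (Suc k)"] exI[of _ A] conjI allI impI)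
    show "A n \<in> sets borel" "A n \<subseteq> S" for n
      using A[of n] unfolding good_def by blast+
  qed (simp_all add: good_def)
qed

text \<open>
  The limes superior is covered by \<open>A m, ..., A k\<close>, which contribute a geometric tail, and by the
  rest of the union of all \<open>A n\<close> with \<open>n \<ge> m\<close>, whose measure tends to zero as \<open>k\<close> grows.
\<close>
lemma limsup_integral_tendsto_0:
  fixes A :: "nat \<Rightarrow> 'a set" and f :: "nat \<Rightarrow> 'a \<Rightarrow> ennreal"
  assumes S: "S \<in> sets M" "emeasure M S < \<infinity>"
    and f: "\<And>k. f k \<in> borel_measurable M" "\<And>k x. f k x \<le> 1"
    and A: "\<And>n. A n \<in> sets M" "\<And>n. A n \<subseteq> S"
    and small: "\<And>n k. n \<le> k \<Longrightarrow> (\<integral>\<^sup>+x. indicator (A n) x * f k x \<partial>M) \<le> ennreal ((1/2) ^ n)"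
  shows "(\<lambda>k. \<integral>\<^sup>+x. indicator (\<Inter>m. \<Union>n\<in>{m..}. A n) x * f k x \<partial>M) \<longlonglongrightarrow> 0"
proof -
  let ?L = "\<Inter>m. \<Union>n\<in>{m..}. A n"
  define R where "R m k = (\<Union>n\<in>{m..}. A n) - (\<Union>n\<in>{m..k}. A n)" for m k
  have R_sets: "R m k \<in> sets M" for m k
    using A(1) unfolding R_def by auto
  have R_lim: "(\<lambda>k. emeasure M (R m k)) \<longlonglongrightarrow> 0" for m
  proof -
    have "(\<lambda>k. emeasure M (R m k)) \<longlonglongrightarrow> emeasure M (\<Inter>k. R m k)"
    proof (rule Lim_emeasure_decseq)
      show "decseq (R m)" by (auto simp: decseq_def R_def)
      have "emeasure M (R m k) \<le> emeasure M S" for k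
        using A(2) S(1) by (intro emeasure_mono) (auto simp: R_def)
      then show "emeasure M (R m k) \<noteq> \<infinity>" for k
        using S(2) by (metis infinity_ennreal_def linorder_not_less top.extremum_uniqueI)
    qed (use R_sets in auto)
    moreover have "x \<notin> (\<Inter>k. R m k)" for x
      unfolding R_def by auto (meson atLeastAtMost_iff order_refl)
    then have "(\<Inter>k. R m k) = {}" by blast
    ultimately show ?thesis by simp
  qed
  have geometric: "(\<Sum>n\<in>{m..k}. (1/2) ^ n) \<le> 2 * (1/2 :: real) ^ m" for m k :: nat
  proof (cases "m \<le> k")
    case True
    then have "(\<Sum>n\<in>{m..k}. (1/2) ^ n) = 2 * (1/2 :: real) ^ m - (1/2) ^ k"
      by (induction k rule: dec_induct) (auto simp: atLeastAtMostSuc_conv)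
    then show ?thesis by simp
  qed auto
  have bound: "(\<integral>\<^sup>+x. indicator ?L x * f k x \<partial>M) \<le> ennreal (2 * (1/2) ^ m) + emeasure M (R m k)" for m k
  proof -
    have "(\<integral>\<^sup>+x. indicator ?L x * f k x \<partial>M)
        \<le> (\<integral>\<^sup>+x. (\<Sum>n\<in>{m..k}. indicator (A n) x * f k x) + indicator (R m k) x \<partial>M)"
    proof (intro nn_integral_mono)
      fix x
      show "indicator ?L x * f k x \<le> (\<Sum>n\<in>{m..k}. indicator (A n) x * f k x) + indicator (R m k) x"
      proof (cases "\<exists>n\<in>{m..k}. x \<in> A n")
        case True
        then obtain n where n: "n \<in> {m..k}" "x \<in> A n" by blast
        have "indicator ?L x * f k x \<le> indicator (A n) x * f k x"
          using n(2) by (intro mult_right_mono) (auto simp: indicator_def)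
        also have "\<dots> \<le> (\<Sum>n\<in>{m..k}. indicator (A n) x * f k x)"
          using n(1) by (intro member_le_sum) auto
        finally show ?thesis by (simp add: add_increasing2)
      next
        case False
        then have "indicator ?L x \<le> (indicator (R m k) x :: ennreal)"
          by (auto simp: indicator_def R_def)
        then have "indicator ?L x * f k x \<le> indicator (R m k) x * 1"
          using f(2) by (intro mult_mono) auto
        then show ?thesis by (simp add: add_increasing)
      qed
    qed
    also have "\<dots> = (\<Sum>n\<in>{m..k}. \<integral>\<^sup>+x. indicator (A n) x * f k x \<partial>M) + emeasure M (R m k)"
    proof -
      have "(\<lambda>x. indicator (A n) x * f k x) \<in> borel_measurable M" for n
        using A(1) f(1) by measurable
      then have "(\<integral>\<^sup>+x. (\<Sum>n\<in>{m..k}. indicator (A n) x * f k x) \<partial>M)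
          = (\<Sum>n\<in>{m..k}. \<integral>\<^sup>+x. indicator (A n) x * f k x \<partial>M)"
        by (intro nn_integral_sum)
      then show ?thesis
        using R_sets[of m k] A(1) f(1) by (subst nn_integral_add) (auto simp del: sum_mult_indicator)
    qed
    also have "\<dots> \<le> (\<Sum>n\<in>{m..k}. ennreal ((1/2) ^ n)) + emeasure M (R m k)"
      using small by (intro add_right_mono sum_mono) auto
    also have "\<dots> \<le> ennreal (2 * (1/2) ^ m) + emeasure M (R m k)"
      using geometric[of m k] by (intro add_right_mono) (simp add: ennreal_leI)
    finally show ?thesis .
  qed
  show ?thesis
  proof (rule order_tendstoI)
    fix e :: ennreal assume "0 < e"
    have "(\<lambda>m. ennreal (2 * (1/2) ^ m)) \<longlonglongrightarrow> ennreal (2 * 0)"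
      by (intro tendsto_ennrealI tendsto_mult tendsto_const LIMSEQ_realpow_zero) auto
    then have "\<forall>\<^sub>F m in sequentially. ennreal (2 * (1/2) ^ m) < e"
      using \<open>0 < e\<close> by (intro order_tendstoD) auto
    then obtain m where m: "ennreal (2 * (1/2) ^ m) < e"
      by (auto simp: eventually_sequentially)
    have "(\<lambda>k. ennreal (2 * (1/2) ^ m) + emeasure M (R m k)) \<longlonglongrightarrow> ennreal (2 * (1/2) ^ m) + 0"
      by (intro tendsto_add tendsto_const R_lim)
    then have "\<forall>\<^sub>F k in sequentially. ennreal (2 * (1/2) ^ m) + emeasure M (R m k) < e"
      using m by (intro order_tendstoD) auto
    then show "\<forall>\<^sub>F k in sequentially. (\<integral>\<^sup>+x. indicator ?L x * f k x \<partial>M) < e"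
      using bound by (elim eventually_mono) (rule le_less_trans)
  qed simp
qed

text \<open>
  The limes superior of the sets from the diagonal argument works for both sequences: a point
  outside it eventually leaves every \<open>A n\<close>, so it lies in the limes superior of the complements.
\<close>
lemma complementary_vanishing_sets:
  fixes S :: "'a::euclidean_space set" and a b :: "nat \<Rightarrow> 'a \<Rightarrow> ennreal"
  assumes S: "bounded S" "S \<in> sets borel" and pos: "\<rho> > 0" "K \<ge> 0"
    and meas: "\<And>k. a k \<in> borel_measurable borel" "\<And>k. b k \<in> borel_measurable borel"
    and le1: "\<And>k x. a k x \<le> 1" "\<And>k x. b k x \<le> 1"
    and corr: "\<And>k w. norm w \<le> \<rho> \<Longrightarrow>
        (\<integral>\<^sup>+x. indicator S x * (a k x * b k (x + w)) \<partial>lborel) \<le> ennreal (K * norm w)"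
  shows "\<exists>(r::nat \<Rightarrow> nat) E. strict_mono r \<and> E \<in> sets borel \<and> E \<subseteq> S \<and>
    (\<lambda>k. \<integral>\<^sup>+x. indicator E x * a (r k) x \<partial>lborel) \<longlonglongrightarrow> 0 \<and>
    (\<lambda>k. \<integral>\<^sup>+x. indicator (S - E) x * b (r k) x \<partial>lborel) \<longlonglongrightarrow> 0"
proof -
  obtain r A where r: "strict_mono r" and A: "\<And>n. A n \<in> sets borel" "\<And>n. A n \<subseteq> S"
    and small: "\<And>n k. n \<le> k \<Longrightarrow> (\<integral>\<^sup>+x. indicator (A n) x * a (r k) x \<partial>lborel) \<le> ennreal ((1/2) ^ n)"
      "\<And>n k. n \<le> k \<Longrightarrow> (\<integral>\<^sup>+x. indicator (S - A n) x * b (r k) x \<partial>lborel) \<le> ennreal ((1/2) ^ n)"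
    using diagonal_splitting[where a = a and b = b, OF S pos meas corr] by blast
  define E where "E = (\<Inter>m. \<Union>n\<in>{m..}. A n)"
  have fin: "emeasure lborel S < \<infinity>" using S(1) by (rule emeasure_bounded_finite)
  have E: "E \<in> sets borel" "E \<subseteq> S" using A by (auto simp: E_def subset_iff)
  have lim_a: "(\<lambda>k. \<integral>\<^sup>+x. indicator E x * a (r k) x \<partial>lborel) \<longlonglongrightarrow> 0"
    unfolding E_def
    by (rule limsup_integral_tendsto_0[where S = S and f = "\<lambda>k. a (r k)"])
       (use S fin meas le1 A small in auto)
  have lim_b: "(\<lambda>k. \<integral>\<^sup>+x. indicator (\<Inter>m. \<Union>n\<in>{m..}. S - A n) x * b (r k) x \<partial>lborel) \<longlonglongrightarrow> 0"
    by (rule limsup_integral_tendsto_0[where S = S and f = "\<lambda>k. b (r k)"])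
       (use S fin meas le1 A small in auto)
  have sub: "S - E \<subseteq> (\<Inter>m. \<Union>n\<in>{m..}. S - A n)"
  proof
    fix x assume x: "x \<in> S - E"
    then obtain m where "\<And>n. n \<ge> m \<Longrightarrow> x \<notin> A n" by (auto simp: E_def)
    then have "x \<in> S - A (max m m')" for m' using x by auto
    then show "x \<in> (\<Inter>m. \<Union>n\<in>{m..}. S - A n)" by (meson INT_I UN_I atLeast_iff max.cobounded2)
  qed
  have "(\<lambda>k. \<integral>\<^sup>+x. indicator (S - E) x * b (r k) x \<partial>lborel) \<longlonglongrightarrow> 0"
  proof (rule tendsto_sandwich[OF _ _ tendsto_const lim_b])
    show "\<forall>\<^sub>F k in sequentially. (\<integral>\<^sup>+x. indicator (S - E) x * b (r k) x \<partial>lborel)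
        \<le> (\<integral>\<^sup>+x. indicator (\<Inter>m. \<Union>n\<in>{m..}. S - A n) x * b (r k) x \<partial>lborel)"
      using sub by (intro always_eventually allI nn_integral_mono mult_right_mono) (auto simp: indicator_def)
  qed auto
  with r E lim_a show ?thesis by blast
qed

section \<open>Weak limits of transversally controlled sequences\<close>

text \<open>
  Weak convergence in \<open>L\<^sup>1\<close>, tested only with Borel fields of norm at most one; by homogeneity
  this covers all bounded Borel fields.
\<close>
definition weakly_tendsto_L1 ::
    "(nat \<Rightarrow> 'a::euclidean_space \<Rightarrow> 'b::euclidean_space) \<Rightarrow> ('a \<Rightarrow> 'b) \<Rightarrow> bool" where
  "weakly_tendsto_L1 u l \<longleftrightarrow> (\<forall>k. integrable lborel (u k)) \<and> integrable lborel l \<and>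
     (\<forall>h \<in> borel_measurable borel. (\<forall>x. norm (h x) \<le> 1) \<longrightarrow>
        (\<lambda>k. \<integral>x. u k x \<bullet> h x \<partial>lborel) \<longlonglongrightarrow> (\<integral>x. l x \<bullet> h x \<partial>lborel))"

lemma weakly_tendsto_L1_subseq:
  fixes u :: "nat \<Rightarrow> 'a::euclidean_space \<Rightarrow> 'b::euclidean_space"
  assumes "weakly_tendsto_L1 u l" "strict_mono r"
  shows "weakly_tendsto_L1 (\<lambda>k. u (r k)) l"
  unfolding weakly_tendsto_L1_def
proof (intro conjI ballI impI allI)
  fix h :: "'a \<Rightarrow> 'b"
  assume "h \<in> borel_measurable borel" "\<forall>x. norm (h x) \<le> 1"
  then have "(\<lambda>k. \<integral>x. u k x \<bullet> h x \<partial>lborel) \<longlonglongrightarrow> (\<integral>x. l x \<bullet> h x \<partial>lborel)"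
    using assms(1) by (simp add: weakly_tendsto_L1_def)
  from LIMSEQ_subseq_LIMSEQ[OF this assms(2)]
  show "(\<lambda>k. \<integral>x. u (r k) x \<bullet> h x \<partial>lborel) \<longlonglongrightarrow> (\<integral>x. l x \<bullet> h x \<partial>lborel)"
    by (simp add: o_def)
qed (use assms(1) in \<open>simp_all add: weakly_tendsto_L1_def\<close>)

text \<open>
  A subsequence tends to zero almost everywhere on \<open>E\<close>. This does not bound the sequence, but
  \<open>E\<close> is exhausted by sets on which it is eventually bounded by one, and there dominated convergence
  identifies the weak limit.
\<close>
lemma weak_limit_eq_0:
  fixes u :: "nat \<Rightarrow> 'a::euclidean_space \<Rightarrow> 'b::euclidean_space"
  assumes weak: "weakly_tendsto_L1 u l"
    and E: "E \<in> sets borel" "emeasure lborel E < \<infinity>"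
    and lim: "(\<lambda>k. \<integral>\<^sup>+x. indicator E x * ennreal (min 1 (norm (u k x))) \<partial>lborel) \<longlonglongrightarrow> 0"
  shows "AE x in lborel. x \<in> E \<longrightarrow> l x = 0"
proof -
  have int_u: "integrable lborel (u k)" and int_l: "integrable lborel l" for k
    using weak by (auto simp: weakly_tendsto_L1_def)
  have [measurable]: "u k \<in> borel_measurable borel" "l \<in> borel_measurable borel" for k
    using borel_measurable_integrable[OF int_u] borel_measurable_integrable[OF int_l] by auto
  note [measurable] = E(1)
  define t where "t k x = indicator E x * min 1 (norm (u k x))" for k x
  have t_meas [measurable]: "t k \<in> borel_measurable lborel" for k
    unfolding t_def by measurable
  have t_nonneg: "t k x \<ge> 0" for k x by (simp add: t_def)
  have int_t: "integrable lborel (t k)" for k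
  proof (rule Bochner_Integration.integrable_bound[OF int_u[of k]])
    show "AE x in lborel. norm (t k x) \<le> norm (u k x)"
      by (auto simp: t_def indicator_def)
  qed measurable
  have "ennreal (\<integral>x. norm (t k x) \<partial>lborel) = (\<integral>\<^sup>+x. indicator E x * ennreal (min 1 (norm (u k x))) \<partial>lborel)" for k
  proof -
    have "ennreal (\<integral>x. t k x \<partial>lborel) = (\<integral>\<^sup>+x. ennreal (t k x) \<partial>lborel)"
      using int_t t_nonneg by (intro nn_integral_eq_integral[symmetric]) auto
    then show ?thesis using t_nonneg by (simp add: t_def ennreal_mult ennreal_indicator)
  qed
  then have "(\<lambda>k. ennreal (\<integral>x. norm (t k x) \<partial>lborel)) \<longlonglongrightarrow> ennreal 0"
    using lim by simp
  then have "(\<lambda>k. \<integral>x. norm (t k x) \<partial>lborel) \<longlonglongrightarrow> 0"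
    by (subst (asm) tendsto_ennreal_iff) auto
  from tendsto_L1_AE_subseq[OF int_t this]
  obtain r :: "nat \<Rightarrow> nat" where r: "strict_mono r" and ae: "AE x in lborel. (\<lambda>k. t (r k) x) \<longlonglongrightarrow> 0"
    by blast
  have u_lim: "(\<lambda>k. u (r k) x) \<longlonglongrightarrow> 0" if "x \<in> E" "(\<lambda>k. t (r k) x) \<longlonglongrightarrow> 0" for x
  proof -
    have "\<forall>\<^sub>F k in sequentially. t (r k) x < 1"
      using that(2) by (rule order_tendstoD) simp
    then have "\<forall>\<^sub>F k in sequentially. t (r k) x = norm (u (r k) x)"
      using that(1) by (auto elim!: eventually_mono simp: t_def min_def split: if_splits)
    then have "(\<lambda>k. norm (u (r k) x)) \<longlonglongrightarrow> 0"
      using that(2) tendsto_cong by fastforce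
    then show ?thesis by (rule tendsto_norm_zero_cancel)
  qed
  \<comment> \<open>On each \<open>F n\<close> the sequence is dominated by one, so that its weak and its pointwise
     limit can be compared; the sets \<open>F n\<close> exhaust \<open>E\<close>.\<close>
  define F where "F n = {x \<in> E. \<forall>k\<ge>n. norm (u (r k) x) \<le> 1}" for n
  have F_sets [measurable]: "F n \<in> sets borel" for n unfolding F_def by measurable
  have F_zero: "AE x in lborel. x \<in> F n \<longrightarrow> l x = 0" for n
  proof -
    define h where "h x = indicator (F n) x *\<^sub>R sgn (l x)" for x
    have h_meas [measurable]: "h \<in> borel_measurable borel" unfolding h_def by measurable
    have h_le: "norm (h x) \<le> 1" for x by (auto simp: h_def norm_sgn indicator_def)
    have "(\<lambda>k. \<integral>x. u (r k) x \<bullet> h x \<partial>lborel) \<longlonglongrightarrow> (\<integral>x. l x \<bullet> h x \<partial>lborel)"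
      using weakly_tendsto_L1_subseq[OF weak r] h_meas h_le by (simp add: weakly_tendsto_L1_def)
    then have "(\<lambda>k. \<integral>x. u (r (k + n)) x \<bullet> h x \<partial>lborel) \<longlonglongrightarrow> (\<integral>x. l x \<bullet> h x \<partial>lborel)"
      by (rule LIMSEQ_ignore_initial_segment)
    moreover have "(\<lambda>k. \<integral>x. u (r (k + n)) x \<bullet> h x \<partial>lborel) \<longlonglongrightarrow> (\<integral>x. (0::real) \<partial>(lborel :: 'a measure))"
    proof (rule integral_dominated_convergence[where w = "indicator E"])
      show "integrable lborel (indicator E :: 'a \<Rightarrow> real)"
        using E by (intro integrable_real_indicator) auto
      show "AE x in lborel. (\<lambda>k. u (r (k + n)) x \<bullet> h x) \<longlonglongrightarrow> 0"
        using ae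
      proof eventually_elim
        case (elim x)
        show ?case
        proof (cases "x \<in> E")
          case True
          have "(\<lambda>k. u (r (k + n)) x \<bullet> h x) \<longlonglongrightarrow> 0 \<bullet> h x"
            by (intro tendsto_inner tendsto_const LIMSEQ_ignore_initial_segment[of "\<lambda>k. u (r k) x"] u_lim True elim)
          then show ?thesis by simp
        qed (simp add: h_def F_def)
      qed
      have "\<bar>u (r (k + n)) x \<bullet> h x\<bar> \<le> indicator E x" for k x
      proof (cases "x \<in> F n")
        case True
        have "\<bar>u (r (k + n)) x \<bullet> h x\<bar> \<le> norm (u (r (k + n)) x) * norm (h x)"
          by (rule Cauchy_Schwarz_ineq2)
        also have "\<dots> \<le> 1 * 1"
          using True h_le by (intro mult_mono) (auto simp: F_def)
        finally show ?thesis using True by (simp add: F_def)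
      qed (simp add: h_def)
      then show "AE x in lborel. norm (u (r (k + n)) x \<bullet> h x) \<le> indicator E x" for k by simp
    qed measurable
    ultimately have "(\<integral>x. l x \<bullet> h x \<partial>lborel) = 0"
      using LIMSEQ_unique by fastforce
    moreover have pos: "l x \<bullet> h x = indicator (F n) x * norm (l x)" for x
      by (cases "l x = 0") (simp_all add: h_def sgn_div_norm power2_eq_square flip: power2_norm_eq_inner)
    moreover have "integrable lborel (\<lambda>x. l x \<bullet> h x)"
      by (rule integrable_inner_bounded[OF int_l h_meas h_le])
    ultimately have "AE x in lborel. l x \<bullet> h x = 0"
      by (subst integral_nonneg_eq_0_iff_AE[symmetric]) auto
    then show ?thesis by (auto simp: pos elim!: eventually_mono)
  qed
  have "AE x in lborel. \<forall>n. x \<in> F n \<longrightarrow> l x = 0"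
    unfolding AE_all_countable using F_zero by blast
  with ae show ?thesis
  proof eventually_elim
    case (elim x)
    show ?case
    proof
      assume "x \<in> E"
      then have "(\<lambda>k. norm (u (r k) x)) \<longlonglongrightarrow> 0"
        using u_lim elim(1) tendsto_norm_zero by blast
      then have "\<forall>\<^sub>F k in sequentially. norm (u (r k) x) < 1"
        by (rule order_tendstoD) simp
      then obtain n where "\<And>k. k \<ge> n \<Longrightarrow> norm (u (r k) x) < 1"
        by (auto simp: eventually_sequentially)
      then have "x \<in> F n" using \<open>x \<in> E\<close> by (auto simp: F_def intro: less_imp_le)
      then show "l x = 0" using elim(2) by blast
    qed
  qed
qed

text \<open>
  Two distinct planes through the origin span the whole space.
\<close>
lemma split_along_two_planes:
  fixes m n :: "'a::euclidean_space"
  assumes "independent {m, n}" "m \<noteq> n"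
  shows "\<exists>C\<ge>0. \<forall>w. \<exists>w1 w2. w = w1 + w2 \<and> w1 \<in> {m}\<^sup>\<bottom> \<and> w2 \<in> {n}\<^sup>\<bottom> \<and>
    norm w1 \<le> C * norm w \<and> norm w2 \<le> C * norm w"
proof -
  \<comment> \<open>the component of \<open>m\<close> orthogonal to \<open>n\<close>\<close>
  define e where "e = m - ((m \<bullet> n) / (n \<bullet> n)) *\<^sub>R n"
  have "m \<notin> span {n}" "n \<noteq> 0"
    using assms by (auto simp: independent_insert dependent_single)
  then have "e \<noteq> 0" by (auto simp: e_def span_singleton)
  have en: "e \<bullet> n = 0" using \<open>n \<noteq> 0\<close> by (simp add: e_def inner_diff_left)
  have "e \<bullet> m = e \<bullet> e" using en by (simp add: e_def inner_diff_right inner_commute)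
  with \<open>e \<noteq> 0\<close> have em: "e \<bullet> m > 0" by simp
  define C where "C = 1 + norm m * norm e / (e \<bullet> m)"
  have "\<exists>w1 w2. w = w1 + w2 \<and> w1 \<in> {m}\<^sup>\<bottom> \<and> w2 \<in> {n}\<^sup>\<bottom> \<and>
    norm w1 \<le> C * norm w \<and> norm w2 \<le> C * norm w" for w
  proof -
    define w2 where "w2 = ((w \<bullet> m) / (e \<bullet> m)) *\<^sub>R e"
    have "\<bar>w \<bullet> m\<bar> * norm e / (e \<bullet> m) \<le> norm w * norm m * norm e / (e \<bullet> m)"
      using em Cauchy_Schwarz_ineq2[of w m] by (intro divide_right_mono mult_right_mono) auto
    then have w2: "norm w2 \<le> (C - 1) * norm w"
      using em by (simp add: w2_def C_def mult_ac)
    have "norm (w - w2) \<le> C * norm w"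
      using norm_triangle_ineq4[of w w2] w2 by (simp add: left_diff_distrib)
    moreover have "w - w2 \<in> {m}\<^sup>\<bottom>"
      using em by (simp add: w2_def orthogonal_comp_def orthogonal_def inner_diff_right inner_commute)
    moreover have "w2 \<in> {n}\<^sup>\<bottom>"
      using en by (simp add: w2_def orthogonal_comp_def orthogonal_def inner_commute)
    moreover have "norm w2 \<le> C * norm w" 
      using w2 norm_ge_zero[of w] unfolding left_diff_distrib by linarith
    ultimately show ?thesis by (intro exI[of _ "w - w2"] exI[of _ w2]) simp
  qed
  moreover have "C \<ge> 0" using em by (simp add: C_def)
  ultimately show ?thesis by blast
qed

text \<open>
  Let \<open>a\<close> and \<open>b'\<close> be the truncations of \<open>u\<close> at \<open>x\<close> and of \<open>v\<close> at \<open>x + w1 + w2\<close>, and let \<open>a'\<close> and \<open>b\<close>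
  be those of \<open>u\<close> and \<open>v\<close> at the intermediate point \<open>x + w1\<close>. Since \<open>a' b = 0\<close>, the product \<open>a b'\<close>
  equals \<open>(a - a') b' + a' (b' - b)\<close>. Truncation at one makes each summand at most an increment of \<open>u\<close>
  or of \<open>v\<close>.
\<close>
lemma correlation_bound:
  fixes u v :: "'a::euclidean_space \<Rightarrow> 'b::euclidean_space"
  assumes [measurable]: "u \<in> borel_measurable borel" "v \<in> borel_measurable borel"
    and disj: "AE x in lborel. u x = 0 \<or> v x = 0"
    and u: "(\<integral>\<^sup>+x. indicator (ball c r) x * ennreal (norm (u (x + w1) - u x)) \<partial>lborel) \<le> ennreal K1"
    and v: "(\<integral>\<^sup>+x. indicator (ball c (r + norm w1)) x * ennreal (norm (v (x + w2) - v x)) \<partial>lborel) \<le> ennreal K2"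
    and K: "K1 \<ge> 0" "K2 \<ge> 0"
  shows "(\<integral>\<^sup>+x. indicator (ball c r) x *
      (ennreal (min 1 (norm (u x))) * ennreal (min 1 (norm (v (x + (w1 + w2)))))) \<partial>lborel) \<le> ennreal (K1 + K2)"
proof -
  have [measurable]: "ball c \<rho> \<in> sets borel" for \<rho> by simp
  let ?du = "\<lambda>x. indicator (ball c r) x * ennreal (norm (u (x + w1) - u x))"
  let ?dv = "\<lambda>x. indicator (ball c (r + norm w1)) x * ennreal (norm (v (x + w2) - v x))"
  have "AE x in lborel. u (x + w1) = 0 \<or> v (x + w1) = 0"
  proof -
    have "AE x in distr lborel borel ((+) w1). u x = 0 \<or> v x = 0"
      unfolding lborel_distr_plus by (rule disj)
    then show ?thesis by (subst (asm) AE_distr_iff) (auto simp: add.commute)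
  qed
  then have "(\<integral>\<^sup>+x. indicator (ball c r) x *
      (ennreal (min 1 (norm (u x))) * ennreal (min 1 (norm (v (x + (w1 + w2)))))) \<partial>lborel)
      \<le> (\<integral>\<^sup>+x. ?du x + ?dv (x + w1) \<partial>lborel)"
  proof (intro nn_integral_mono_AE, eventually_elim)
    case (elim x)
    show ?case
    proof (cases "x \<in> ball c r")
      case True
      have "norm (x + w1 - c) \<le> norm (x - c) + norm w1"
        using norm_triangle_ineq[of "x - c" w1] by (simp add: algebra_simps)
      then have in2: "x + w1 \<in> ball c (r + norm w1)"
        using True by (simp add: dist_norm norm_minus_commute)
      define a a' b b' where "a = min 1 (norm (u x))" and "a' = min 1 (norm (u (x + w1)))"
        and "b = min 1 (norm (v (x + w1)))" and "b' = min 1 (norm (v (x + (w1 + w2))))"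
      have "\<bar>a - a'\<bar> \<le> norm (u (x + w1) - u x)"
        using norm_triangle_ineq3[of "u (x + w1)" "u x"] unfolding a_def a'_def by linarith
      moreover have "\<bar>b' - b\<bar> \<le> norm (v (x + w1 + w2) - v (x + w1))"
        using norm_triangle_ineq3[of "v (x + w1 + w2)" "v (x + w1)"]
        unfolding b_def b'_def add.assoc by linarith
      moreover have "a * b' \<le> \<bar>a - a'\<bar> + \<bar>b' - b\<bar>"
      proof -
        have "a' * b = 0" using elim by (auto simp: a'_def b_def)
        then have "a * b' = (a - a') * b' + a' * (b' - b)" by (simp add: algebra_simps)
        also have "\<dots> \<le> \<bar>a - a'\<bar> * b' + a' * \<bar>b' - b\<bar>"
          by (intro add_mono mult_right_mono mult_left_mono abs_ge_self) (simp_all add: a'_def b'_def)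
        also have "\<dots> \<le> \<bar>a - a'\<bar> + \<bar>b' - b\<bar>"
          by (intro add_mono mult_left_le mult_left_le_one_le) (simp_all add: a'_def b'_def)
        finally show ?thesis .
      qed
      ultimately have "a * b' \<le> norm (u (x + w1) - u x) + norm (v (x + w1 + w2) - v (x + w1))"
        by linarith
      then have "ennreal (a * b') \<le> ennreal (norm (u (x + w1) - u x)) + ennreal (norm (v (x + w1 + w2) - v (x + w1)))"
        by (simp add: ennreal_leI flip: ennreal_plus)
      then show ?thesis
        using True in2 by (simp add: a_def b'_def flip: ennreal_mult)
    qed simp
  qed
  also have "\<dots> = (\<integral>\<^sup>+x. ?du x \<partial>lborel) + (\<integral>\<^sup>+x. ?dv (x + w1) \<partial>lborel)"
    by (intro nn_integral_add) measurable
  also have "(\<integral>\<^sup>+x. ?dv (x + w1) \<partial>lborel) = (\<integral>\<^sup>+x. ?dv x \<partial>lborel)"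
    by (rule lborel_translate(2)) measurable
  also have "(\<integral>\<^sup>+x. ?du x \<partial>lborel) + (\<integral>\<^sup>+x. ?dv x \<partial>lborel) \<le> ennreal (K1 + K2)"
    using add_mono[OF u v] K by simp
  finally show ?thesis .
qed

lemma weak_limits_disjoint_on_ball:
  fixes u v :: "nat \<Rightarrow> 'a::euclidean_space \<Rightarrow> 'b::euclidean_space"
  assumes mn: "independent {m, n}" "m \<noteq> n" and pos: "R > 0" "K \<ge> 0"
    and u: "weakly_tendsto_L1 u u'" and v: "weakly_tendsto_L1 v v'"
    and disj: "\<And>k. AE x in lborel. u k x = 0 \<or> v k x = 0"
    and tu: "\<And>k w r. w \<in> {m}\<^sup>\<bottom> \<Longrightarrow> 0 < r \<Longrightarrow> r + norm w \<le> R \<Longrightarrow>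
      (\<integral>\<^sup>+x. indicator (ball c r) x * ennreal (norm (u k (x + w) - u k x)) \<partial>lborel) \<le> ennreal (K * norm w)"
    and tv: "\<And>k w r. w \<in> {n}\<^sup>\<bottom> \<Longrightarrow> 0 < r \<Longrightarrow> r + norm w \<le> R \<Longrightarrow>
      (\<integral>\<^sup>+x. indicator (ball c r) x * ennreal (norm (v k (x + w) - v k x)) \<partial>lborel) \<le> ennreal (K * norm w)"
  shows "AE x in lborel. x \<in> ball c (R / 2) \<longrightarrow> u' x = 0 \<or> v' x = 0"
proof -
  let ?S = "ball c (R / 2)"
  have meas: "u k \<in> borel_measurable borel" "v k \<in> borel_measurable borel" for k
    using u v borel_measurable_integrable[of lborel "u k"] borel_measurable_integrable[of lborel "v k"]
    by (auto simp: weakly_tendsto_L1_def)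
  obtain C where C: "C \<ge> 0" and split: "\<forall>w. \<exists>w1 w2. w = w1 + w2 \<and> w1 \<in> {m}\<^sup>\<bottom> \<and> w2 \<in> {n}\<^sup>\<bottom> \<and>
    norm w1 \<le> C * norm w \<and> norm w2 \<le> C * norm w"
    using split_along_two_planes[OF mn] by (elim exE conjE)
  \<comment> \<open>Both parts of a vector of norm at most \<open>\<rho>\<close> have norm at most \<open>R / 4\<close>, so points of the ball of
     radius \<open>R / 2\<close> stay within radius \<open>R\<close> after both translations.\<close>
  define \<rho> where "\<rho> = R / (4 * (C + 1))"
  have "\<rho> > 0" using pos C by (simp add: \<rho>_def)
  have "C * \<rho> \<le> R / 4"
  proof -
    have "C * \<rho> \<le> (C + 1) * \<rho>" using \<open>\<rho> > 0\<close> by simp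
    also have "(C + 1) * \<rho> = R / 4" using C by (simp add: \<rho>_def divide_simps)
    finally show ?thesis .
  qed
  have corr: "(\<integral>\<^sup>+x. indicator ?S x *
      (ennreal (min 1 (norm (u k x))) * ennreal (min 1 (norm (v k (x + w))))) \<partial>lborel)
      \<le> ennreal (2 * K * C * norm w)" if w: "norm w \<le> \<rho>" for k w
  proof -
    obtain w1 w2 where ww: "w = w1 + w2" "w1 \<in> {m}\<^sup>\<bottom>" "w2 \<in> {n}\<^sup>\<bottom>"
      "norm w1 \<le> C * norm w" "norm w2 \<le> C * norm w"
      using split[rule_format, of w] by (elim exE conjE)
    have "C * norm w \<le> R / 4"
      using mult_left_mono[OF w C] \<open>C * \<rho> \<le> R / 4\<close> by linarith
    then have small: "norm w1 \<le> R / 4" "norm w2 \<le> R / 4" using ww by linarith+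
    have "(\<integral>\<^sup>+x. indicator ?S x *
        (ennreal (min 1 (norm (u k x))) * ennreal (min 1 (norm (v k (x + (w1 + w2)))))) \<partial>lborel)
        \<le> ennreal (K * norm w1 + K * norm w2)"
      using pos small norm_ge_zero[of w1]
      by (intro correlation_bound meas disj tu tv ww) (auto intro: add_pos_nonneg)
    also have "\<dots> \<le> ennreal (2 * K * C * norm w)"
      using mult_left_mono[OF ww(4) pos(2)] mult_left_mono[OF ww(5) pos(2)]
      by (intro ennreal_leI) (simp add: algebra_simps)
    finally show ?thesis by (simp add: ww(1))
  qed
  have "\<exists>(r::nat \<Rightarrow> nat) E. strict_mono r \<and> E \<in> sets borel \<and> E \<subseteq> ?S \<and>
    (\<lambda>k. \<integral>\<^sup>+x. indicator E x * ennreal (min 1 (norm (u (r k) x))) \<partial>lborel) \<longlonglongrightarrow> 0 \<and>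
    (\<lambda>k. \<integral>\<^sup>+x. indicator (?S - E) x * ennreal (min 1 (norm (v (r k) x))) \<partial>lborel) \<longlonglongrightarrow> 0"
  proof (rule complementary_vanishing_sets[OF _ _ \<open>\<rho> > 0\<close> _ _ _ _ _ corr])
    show "(\<lambda>x. ennreal (min 1 (norm (u k x)))) \<in> borel_measurable borel"
      "(\<lambda>x. ennreal (min 1 (norm (v k x)))) \<in> borel_measurable borel" for k
      using meas by measurable
    show "0 \<le> 2 * K * C" using pos C by simp
  qed auto
  then obtain r :: "nat \<Rightarrow> nat" and E where r: "strict_mono r" and E: "E \<in> sets borel" "E \<subseteq> ?S"
    and lim: "(\<lambda>k. \<integral>\<^sup>+x. indicator E x * ennreal (min 1 (norm (u (r k) x))) \<partial>lborel) \<longlonglongrightarrow> 0"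
    "(\<lambda>k. \<integral>\<^sup>+x. indicator (?S - E) x * ennreal (min 1 (norm (v (r k) x))) \<partial>lborel) \<longlonglongrightarrow> 0"
    by blast
  have fin: "emeasure lborel F < \<infinity>" if "F \<subseteq> ?S" for F
    using that bounded_ball bounded_subset by (blast intro: emeasure_bounded_finite)
  have "AE x in lborel. x \<in> E \<longrightarrow> u' x = 0"
    by (rule weak_limit_eq_0[OF weakly_tendsto_L1_subseq[OF u r] E(1) fin[OF E(2)] lim(1)])
  moreover have "AE x in lborel. x \<in> ?S - E \<longrightarrow> v' x = 0"
    by (rule weak_limit_eq_0[OF weakly_tendsto_L1_subseq[OF v r] _ fin lim(2)]) (use E(1) in auto)
  ultimately show ?thesis by eventually_elim auto
qed

section \<open>From \<open>L\<^sup>p\<close> on the domain to \<open>L\<^sup>1\<close> on the whole space\<close>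

text \<open>
  For a function of norm one, integrate \<open>t \<le> 1 + t powr p\<close>; homogeneity gives the general case.
\<close>
lemma Lp_L1_bound:
  fixes f :: "'a::euclidean_space \<Rightarrow> 'b::euclidean_space"
  assumes \<Omega>: "\<Omega> \<in> lmeasurable" and p: "p \<ge> 1" and f: "f \<in> Lp p \<Omega>"
  shows "integrable (lebesgue_on \<Omega>) f"
    and "(LINT x|lebesgue_on \<Omega>. norm (f x)) \<le> (measure lebesgue \<Omega> + 1) * Lp_norm p \<Omega> f"
proof -
  interpret finite_measure "lebesgue_on \<Omega>" using \<Omega> by (rule finite_measure_lebesgue_on)
  have meas: "f \<in> borel_measurable (lebesgue_on \<Omega>)"
    and int: "integrable (lebesgue_on \<Omega>) (\<lambda>x. norm (f x) powr p)"
    using f by (auto simp: Lp_def)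
  have young: "t \<le> 1 + t powr p" if "t \<ge> 0" for t :: real
  proof (cases "t \<le> 1")
    case False
    then have "t powr 1 \<le> t powr p" using p by (intro powr_mono) auto
    then show ?thesis using False by simp
  qed (simp add: add_increasing2)
  show int_f: "integrable (lebesgue_on \<Omega>) f"
  proof (rule Bochner_Integration.integrable_bound)
    show "integrable (lebesgue_on \<Omega>) (\<lambda>x. 1 + norm (f x) powr p)" using int by simp
    have "norm (f x) \<le> norm (1 + norm (f x) powr p)" for x
      using young[of "norm (f x)"] by (simp add: abs_of_nonneg add_nonneg_nonneg)
    then show "AE x in lebesgue_on \<Omega>. norm (f x) \<le> norm (1 + norm (f x) powr p)"
      by (rule AE_I2)
  qed (rule meas)
  define J where "J = (LINT x|lebesgue_on \<Omega>. norm (f x) powr p)"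
  have "J \<ge> 0" unfolding J_def by (rule integral_nonneg_AE) simp
  show "(LINT x|lebesgue_on \<Omega>. norm (f x)) \<le> (measure lebesgue \<Omega> + 1) * Lp_norm p \<Omega> f"
  proof (cases "J = 0")
    case True
    then have "AE x in lebesgue_on \<Omega>. norm (f x) powr p = 0"
      using integral_nonneg_eq_0_iff_AE[OF int] by (simp add: J_def)
    then have "AE x in lebesgue_on \<Omega>. norm (f x) = 0"
      by eventually_elim simp
    then have "(LINT x|lebesgue_on \<Omega>. norm (f x)) = (LINT x|lebesgue_on \<Omega>. 0)"
      using meas by (intro integral_cong_AE) auto
    then show ?thesis by (simp add: Lp_norm_def)
  next
    case False
    define c where "c = J powr (1 / p)"
    have "c > 0" using False by (simp add: c_def)
    have c_powr: "c powr p = J" using False \<open>J \<ge> 0\<close> p by (simp add: c_def powr_powr)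
    have "norm (f x) \<le> c * (1 + norm (f x) powr p / J)" for x
    proof -
      have "norm (f x) / c \<le> 1 + (norm (f x) / c) powr p"
        using \<open>c > 0\<close> by (intro young) simp
      also have "(norm (f x) / c) powr p = norm (f x) powr p / J"
        using \<open>c > 0\<close> c_powr by (simp add: powr_divide)
      finally show ?thesis using \<open>c > 0\<close> by (simp add: pos_divide_le_eq mult.commute)
    qed
    then have "(LINT x|lebesgue_on \<Omega>. norm (f x))
        \<le> (LINT x|lebesgue_on \<Omega>. c * (1 + norm (f x) powr p / J))"
      using int int_f by (intro integral_mono) auto
    also have "\<dots> = c * (measure (lebesgue_on \<Omega>) (space (lebesgue_on \<Omega>)) + J / J)"
      using int by (simp add: J_def)
    also have "\<dots> = c * (measure lebesgue \<Omega> + 1)"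
      using False \<Omega> by (simp add: measure_restrict_space)
    finally show ?thesis by (simp add: Lp_norm_def c_def J_def mult.commute)
  qed
qed

lemma bounded_field_in_Lp_dual:
  fixes h :: "'a::euclidean_space \<Rightarrow> 'b::euclidean_space"
  assumes \<Omega>: "\<Omega> \<in> lmeasurable" and p: "p \<ge> 1"
    and h: "h \<in> borel_measurable (lebesgue_on \<Omega>)" "\<And>x. norm (h x) \<le> 1"
  shows "(\<lambda>f. LINT x|lebesgue_on \<Omega>. f x \<bullet> h x) \<in> Lp_dual p \<Omega>"
proof -
  have bound: "\<bar>f x \<bullet> h x\<bar> \<le> norm (f x)" for f :: "'a \<Rightarrow> 'b" and x
    using Cauchy_Schwarz_ineq2[of "f x" "h x"] mult_left_le[OF h(2)[of x] norm_ge_zero[of "f x"]]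
    by linarith
  have int: "integrable (lebesgue_on \<Omega>) (\<lambda>x. f x \<bullet> h x)" if "f \<in> Lp p \<Omega>" for f
  proof (rule Bochner_Integration.integrable_bound[OF Lp_L1_bound(1)[OF \<Omega> p that]])
    show "(\<lambda>x. f x \<bullet> h x) \<in> borel_measurable (lebesgue_on \<Omega>)"
      using that h(1) by (intro borel_measurable_inner) (auto simp: Lp_def)
  qed (simp add: bound)
  have "\<bar>LINT x|lebesgue_on \<Omega>. f x \<bullet> h x\<bar> \<le> (measure lebesgue \<Omega> + 1) * Lp_norm p \<Omega> f"
    if f: "f \<in> Lp p \<Omega>" for f
  proof -
    have "\<bar>LINT x|lebesgue_on \<Omega>. f x \<bullet> h x\<bar> \<le> (LINT x|lebesgue_on \<Omega>. \<bar>f x \<bullet> h x\<bar>)"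
      by (rule integral_abs_bound)
    also have "\<dots> \<le> (LINT x|lebesgue_on \<Omega>. norm (f x))"
      by (intro integral_mono integrable_abs integrable_norm int[OF f] Lp_L1_bound(1)[OF \<Omega> p f] bound)
    finally have "\<bar>LINT x|lebesgue_on \<Omega>. f x \<bullet> h x\<bar> \<le> (LINT x|lebesgue_on \<Omega>. norm (f x))" .
    then show ?thesis using Lp_L1_bound(2)[OF \<Omega> p f] by linarith
  qed
  then show ?thesis
    unfolding Lp_dual_def using int by (auto simp: inner_add_left)
qed

lemma weakly_tendsto_L1_zero_extensions:
  fixes f :: "nat \<Rightarrow> 'a::euclidean_space \<Rightarrow> 'b::euclidean_space"
  assumes \<Omega>: "\<Omega> \<in> sets borel" "\<Omega> \<in> lmeasurable" and p: "p \<ge> 1"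
    and weak: "Lp_weakly_tendsto p \<Omega> f l"
    and ext: "\<And>k. zero_extension \<Omega> (f k) (u k)" "zero_extension \<Omega> l u'"
  shows "weakly_tendsto_L1 u u'"
proof -
  have Lp: "f k \<in> Lp p \<Omega>" "l \<in> Lp p \<Omega>" for k
    using weak by (auto simp: Lp_weakly_tendsto_def)
  then have meas: "f k \<in> borel_measurable (lebesgue_on \<Omega>)" "l \<in> borel_measurable (lebesgue_on \<Omega>)" for k
    by (auto simp: Lp_def)
  have int: "integrable lborel v" if "g \<in> Lp p \<Omega>" "zero_extension \<Omega> g v" for g v :: "'a \<Rightarrow> 'b"
  proof -
    have "g \<in> borel_measurable (lebesgue_on \<Omega>)" "v \<in> borel_measurable borel"
      using that by (auto simp: Lp_def zero_extension_def)
    then show ?thesis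
      using zero_extension_integral(1)[OF \<Omega>(1) that(2), of "\<lambda>y x. y"] Lp_L1_bound(1)[OF \<Omega>(2) p that(1)]
      by simp
  qed
  show ?thesis
    unfolding weakly_tendsto_L1_def
  proof (intro conjI allI ballI impI)
    show "integrable lborel (u k)" for k by (rule int[OF Lp(1) ext(1)])
    show "integrable lborel u'" by (rule int[OF Lp(2) ext(2)])
    fix h :: "'a \<Rightarrow> 'b"
    assume h: "h \<in> borel_measurable borel" "\<forall>x. norm (h x) \<le> 1"
    have "h \<in> borel_measurable (lebesgue_on \<Omega>)"
      using h(1) by (intro measurable_restrict_space1) (simp add: measurable_completion)
    then have "(\<lambda>g. LINT x|lebesgue_on \<Omega>. g x \<bullet> h x) \<in> Lp_dual p \<Omega>"
      using h(2) by (intro bounded_field_in_Lp_dual \<Omega> p) auto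
    then have "(\<lambda>k. LINT x|lebesgue_on \<Omega>. f k x \<bullet> h x) \<longlonglongrightarrow> (LINT x|lebesgue_on \<Omega>. l x \<bullet> h x)"
      using weak by (auto simp: Lp_weakly_tendsto_def)
    then show "(\<lambda>k. \<integral>x. u k x \<bullet> h x \<partial>lborel) \<longlonglongrightarrow> (\<integral>x. u' x \<bullet> h x \<partial>lborel)"
      using zero_extension_pairing[OF \<Omega>(1) ext(1) meas(1) h(1)]
        zero_extension_pairing[OF \<Omega>(1) ext(2) meas(2) h(1)] by simp
  qed
qed

text \<open>
  Testing with the bounded field \<open>sgn (l x \<bullet> m) m / |m|\<close> measures the \<open>L\<^sup>1\<close> norm of \<open>l \<bullet> m\<close>.
\<close>
lemma weak_limit_orthogonal:
  fixes u :: "nat \<Rightarrow> 'a::euclidean_space \<Rightarrow> 'a"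
  assumes weak: "weakly_tendsto_L1 u l" and u: "\<And>k. AE x in lborel. u k x \<bullet> m = 0" and "m \<noteq> 0"
  shows "AE x in lborel. l x \<bullet> m = 0"
proof -
  have int_l: "integrable lborel l" using weak by (simp add: weakly_tendsto_L1_def)
  have [measurable]: "l \<in> borel_measurable borel" using borel_measurable_integrable[OF int_l] by simp
  define h where "h x = (sgn (l x \<bullet> m) / norm m) *\<^sub>R m" for x
  have h_meas: "h \<in> borel_measurable borel" unfolding h_def by measurable
  have h_le: "norm (h x) \<le> 1" for x using \<open>m \<noteq> 0\<close> by (simp add: h_def sgn_if)
  have "(\<lambda>k. \<integral>x. u k x \<bullet> h x \<partial>lborel) \<longlonglongrightarrow> (\<integral>x. l x \<bullet> h x \<partial>lborel)"
    using weak h_meas h_le by (simp add: weakly_tendsto_L1_def)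
  moreover have "(\<integral>x. u k x \<bullet> h x \<partial>lborel) = 0" for k
    by (rule integral_eq_zero_AE) (use u[of k] in \<open>auto elim!: eventually_mono simp: h_def\<close>)
  ultimately have zero: "(\<integral>x. l x \<bullet> h x \<partial>lborel) = 0"
    using LIMSEQ_unique[OF _ tendsto_const] by simp
  have eq: "l x \<bullet> h x = \<bar>l x \<bullet> m\<bar> / norm m" for x
    by (simp add: h_def sgn_if)
  have int: "integrable lborel (\<lambda>x. l x \<bullet> h x)"
    by (rule integrable_inner_bounded[OF int_l h_meas h_le])
  have "AE x in lborel. 0 \<le> l x \<bullet> h x" by (simp add: eq)
  from integral_nonneg_eq_0_iff_AE[OF int this] zero
  have "AE x in lborel. \<bar>l x \<bullet> m\<bar> / norm m = 0" by (simp only: eq)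
  then show ?thesis by eventually_elim (simp add: \<open>m \<noteq> 0\<close>)
qed

text \<open>
  Null sets can be recognised locally, by the Lindeloef property.
\<close>
lemma AE_locally:
  fixes \<Omega> :: "'a::euclidean_space set"
  assumes "\<And>c. c \<in> \<Omega> \<Longrightarrow> \<exists>r>0. AE x in lborel. x \<in> ball c r \<longrightarrow> P x"
  shows "AE x in lborel. x \<in> \<Omega> \<longrightarrow> P x"
proof -
  define Z where "Z = {x \<in> \<Omega>. \<not> P x}"
  have "negligible Z"
  proof (rule locally_negligible_alt[THEN iffD2], rule ballI)
    fix c assume c: "c \<in> Z"
    then have "c \<in> \<Omega>" by (simp add: Z_def)
    from assms[OF this] obtain r where r: "r > 0" and ae: "AE x in lborel. x \<in> ball c r \<longrightarrow> P x"
      by (elim exE conjE)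
    from ae have "AE x in lborel. x \<notin> Z \<inter> ball c r"
      by eventually_elim (auto simp: Z_def)
    then have "\<exists>N\<in>null_sets lborel. Z \<inter> ball c r \<subseteq> N"
      unfolding eventually_ae_filter by (auto simp: subset_iff)
    then have "negligible (Z \<inter> ball c r)"
      by (simp add: negligible_iff_null_sets null_sets_completion_iff2)
    then show "\<exists>U. openin (top_of_set Z) U \<and> c \<in> U \<and> negligible U"
      using c r by (intro exI[of _ "Z \<inter> ball c r"]) (auto intro: openin_open_Int)
  qed
  then have "Z \<in> null_sets lebesgue" by (simp only: negligible_iff_null_sets)
  from AE_not_in[OF this] have "AE x in lborel. x \<notin> Z"
    by (simp only: AE_completion_iff)
  then show ?thesis by eventually_elim (simp add: Z_def)
qed


section \<open>The single-plane condition in the limit\<close>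

theorem lemma8:
  fixes \<Omega> :: "(real ^ 3) set"
    and p :: real
    and N :: nat
    and m e1 e2 :: "nat \<Rightarrow> real ^ 3"
    and s :: "nat \<Rightarrow> nat \<Rightarrow> real ^ 3 \<Rightarrow> real ^ 3"
    and s_lim :: "nat \<Rightarrow> real ^ 3 \<Rightarrow> real ^ 3"
    and K :: real
  assumes "bounded_lipschitz_domain \<Omega>"
    and "p \<ge> 1"
    and "slip_normals N m"
    and "\<And>j. j \<in> {1..N} \<Longrightarrow> orthonormal_basis_of_plane (e1 j) (e2 j) ({m j}\<^sup>\<bottom>)"
    and "\<And>k j. j \<in> {1..N} \<Longrightarrow> s k j \<in> Lp p \<Omega>"
    and P1: "\<And>k. single_plane \<Omega> N m (s k)"
    and P2: "\<And>j. j \<in> {1..N} \<Longrightarrow> Lp_weakly_tendsto p \<Omega> (\<lambda>k. s k j) (s_lim j)"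
    and P3: "\<And>k. (\<Sum>j = 1..N. grad_variation \<Omega> (e1 j) (e2 j) (s k j)) \<le> ereal K"
  shows "single_plane \<Omega> N m s_lim"
proof -
  have "open \<Omega>" "bounded \<Omega>" using assms(1) by (auto simp: bounded_lipschitz_domain_def)
  then have \<Omega>: "\<Omega> \<in> sets borel" "\<Omega> \<in> lmeasurable"
    by (auto simp: lmeasurable_open)
  then have AE_\<Omega>: "(AE x in lebesgue_on \<Omega>. P x) \<longleftrightarrow> (AE x in lborel. x \<in> \<Omega> \<longrightarrow> P x)" for P
    by (subst AE_restrict_space_iff) (auto simp: AE_completion_iff)
  have meas: "s k j \<in> borel_measurable (lebesgue_on \<Omega>)" "s_lim j \<in> borel_measurable (lebesgue_on \<Omega>)"
    if "j \<in> {1..N}" for k j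
    using assms(5)[OF that] P2[OF that] by (auto simp: Lp_def Lp_weakly_tendsto_def)
  have "\<exists>u. zero_extension \<Omega> (s k j) u" "\<exists>u. zero_extension \<Omega> (s_lim j) u" if "j \<in> {1..N}" for k j
    using meas[OF that] by (auto intro!: zero_extension_exists \<Omega>)
  then obtain u u' where ext: "\<And>k j. j \<in> {1..N} \<Longrightarrow> zero_extension \<Omega> (s k j) (u j k)"
    "\<And>j. j \<in> {1..N} \<Longrightarrow> zero_extension \<Omega> (s_lim j) (u' j)"
    by metis
  have weak: "weakly_tendsto_L1 (u j) (u' j)" if "j \<in> {1..N}" for j
    using weakly_tendsto_L1_zero_extensions[OF \<Omega> assms(2) P2[OF that]] ext[OF that] by blast
  have ext_eq: "AE x in lborel. x \<in> \<Omega> \<longrightarrow> u j k x = s k j x" "AE x in lborel. x \<in> \<Omega> \<longrightarrow> u' j x = s_lim j x"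
    and ext_0: "x \<notin> \<Omega> \<Longrightarrow> u j k x = 0" if "j \<in> {1..N}" for j k x
    using ext[OF that] by (auto simp: zero_extension_def)
  have planes: "AE x in lborel. x \<in> \<Omega> \<longrightarrow> (\<forall>j\<in>{1..N}. s k j x \<in> {m j}\<^sup>\<bottom>) \<and>
      (\<forall>i\<in>{1..N}. \<forall>j\<in>{1..N}. i \<noteq> j \<longrightarrow> norm (s k i x) * norm (s k j x) = 0)" for k
    using P1[of k] unfolding single_plane_def AE_\<Omega> .
  have orth: "AE x in lborel. u' j x \<bullet> m j = 0" if j: "j \<in> {1..N}" for j
  proof (rule weak_limit_orthogonal[OF weak[OF j]])
    show "m j \<noteq> 0" using assms(3) j by (auto simp: slip_normals_def)
    show "AE x in lborel. u j k x \<bullet> m j = 0" for k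
      using ext_eq(1)[OF j, of k] planes[of k]
    proof eventually_elim
      case (elim x)
      then show ?case
        using j ext_0[OF j, of x k]
        by (cases "x \<in> \<Omega>") (auto simp: orthogonal_comp_def orthogonal_def inner_commute)
    qed
  qed
  have variation: "grad_variation \<Omega> (e1 j) (e2 j) (s k j) \<le> ereal K" if "j \<in> {1..N}" for k j
  proof -
    have "sum (\<lambda>j. grad_variation \<Omega> (e1 j) (e2 j) (s k j)) {j}
        \<le> (\<Sum>j = 1..N. grad_variation \<Omega> (e1 j) (e2 j) (s k j))"
      using that by (intro sum_mono2 grad_variation_nonneg) auto
    then show ?thesis using P3[of k] by (auto intro: order_trans)
  qed
  have disjoint: "AE x in lborel. x \<in> \<Omega> \<longrightarrow> u' i x = 0 \<or> u' j x = 0"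
    if i: "i \<in> {1..N}" and j: "j \<in> {1..N}" and "i \<noteq> j" for i j
  proof (rule AE_locally)
    fix c assume "c \<in> \<Omega>"
    then obtain R where R: "R > 0" "cball c R \<subseteq> \<Omega>" using \<open>open \<Omega>\<close> open_contains_cball by blast
    have "ereal 0 \<le> ereal K"
      using order_trans[OF grad_variation_nonneg variation[OF i]] by (simp add: zero_ereal_def)
    then have "K \<ge> 0" by simp
    have transl: "(\<integral>\<^sup>+x. indicator (ball c r) x * ennreal (norm (u j k (x + w) - u j k x)) \<partial>lborel)
        \<le> ennreal (K * norm w)"
      if "j \<in> {1..N}" "w \<in> {m j}\<^sup>\<bottom>" "0 < r" "r + norm w \<le> R" for j k w r
      using translation_nn_L1_bound[OF assms(4) _ \<Omega>(1) ext(1) meas(1) _ _ _ R(2) variation]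
        weak that by (simp add: weakly_tendsto_L1_def)
    have "AE x in lborel. x \<in> ball c (R / 2) \<longrightarrow> u' i x = 0 \<or> u' j x = 0"
    proof (rule weak_limits_disjoint_on_ball[OF _ _ R(1) \<open>K \<ge> 0\<close> weak[OF i] weak[OF j] _ transl[OF i] transl[OF j]])
      show "independent {m i, m j}" "m i \<noteq> m j"
        using assms(3) i j \<open>i \<noteq> j\<close> by (auto simp: slip_normals_def)
      show "AE x in lborel. u i k x = 0 \<or> u j k x = 0" for k
        using ext_eq(1)[OF i, of k] ext_eq(1)[OF j, of k] planes[of k]
      proof eventually_elim
        case (elim x)
        then show ?case
          using i j \<open>i \<noteq> j\<close> ext_0[OF i, of x k] by (cases "x \<in> \<Omega>") auto
      qed
    qed
    then show "\<exists>r>0. AE x in lborel. x \<in> ball c r \<longrightarrow> u' i x = 0 \<or> u' j x = 0"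
      using R(1) by (intro exI[of _ "R / 2"]) simp
  qed
  have "AE x in lborel. \<forall>j\<in>{1..N}. (x \<in> \<Omega> \<longrightarrow> u' j x = s_lim j x) \<and> u' j x \<bullet> m j = 0 \<and>
      (\<forall>i\<in>{1..N}. i \<noteq> j \<longrightarrow> x \<in> \<Omega> \<longrightarrow> u' i x = 0 \<or> u' j x = 0)"
  proof (intro AE_finite_allI AE_conjI)
    fix i j assume "j \<in> {1..N}" "i \<in> {1..N}"
    then show "AE x in lborel. i \<noteq> j \<longrightarrow> x \<in> \<Omega> \<longrightarrow> u' i x = 0 \<or> u' j x = 0"
      using disjoint by (cases "i = j") auto
  qed (use ext_eq(2) orth in auto)
  then show ?thesis
    unfolding single_plane_def AE_\<Omega>
  proof eventually_elim
    case (elim x)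
    then show ?case
    proof (intro impI conjI ballI)
      fix j assume "x \<in> \<Omega>" "j \<in> {1..N}"
      then have "u' j x = s_lim j x" "u' j x \<bullet> m j = 0"
        using elim by blast+
      then show "s_lim j x \<in> {m j}\<^sup>\<bottom>"
        by (simp add: orthogonal_comp_def orthogonal_def inner_commute)
    next
      fix i j assume "x \<in> \<Omega>" "i \<in> {1..N}" "j \<in> {1..N}" "i \<noteq> j"
      then have "u' i x = 0 \<or> u' j x = 0" "u' i x = s_lim i x" "u' j x = s_lim j x"
        using elim by blast+
      then show "norm (s_lim i x) * norm (s_lim j x) = 0" by auto
    qed
  qed
qed

end
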